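(* Let $q$ be a prime power, let $n\ge 2$ be an integer, and let $G$ be the additive group of $\mathbb{F}_q^n$. Let $\mathbb{F}_q^*$ act on $G$ by scalar multiplication and put $K:=\mathbb{F}_q^n\rtimes\mathbb{F}_q^*$, viewed as the group of permutations $x\mapsto \lambda x+b$ ($\lambda\in\mathbb{F}_q^*$, $b\in\mathbb{F}_q^n$) of $\mathbb{F}_q^n$; here $G$ is identified with the subgroup of translations $x\mapsto x+b$. Let $S\subseteq G$ with $S=-S$, and let $\Gamma=\mathrm{Cay}(G,S)$. If $K\le \mathrm{Aut}(\Gamma)$, then either (i) $\mathrm{Aut}(\Gamma)=K$, or (ii) there exists $\varphi\in\mathrm{Aut}(\Gamma)\setminus K$ that normalizes $G$ (i.e. $\varphi G\varphi^{-1}=G$ in the group of permutations of $\mathbb{F}_q^n$).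
   Context: For an abelian group $A$ (written additively) and an inverse-closed subset $S\subseteq A$ (i.e. $S=-S$), the Cayley graph $\mathrm{Cay}(A,S)$ has vertex set $A$, with $u,v$ adjacent iff $u-v\in S$. $\mathrm{Aut}(\Gamma)$ denotes the full automorphism group of the graph $\Gamma$, regarded as a group of permutations of its vertex set. *)

theory Defs
  imports "HOL-Analysis.Analysis"
begin

text \<open>
  A graph whose vertex set is a whole type is given by its adjacency relation. Loops are not
  excluded, so \<open>0 \<in> S\<close> is allowed below; all vertices then carry a loop, which does not change
  the automorphism group.
\<close>

definition cayley_graph :: "'a::ab_group_add set \<Rightarrow> 'a \<Rightarrow> 'a \<Rightarrow> bool" where
  "cayley_graph S u v \<longleftrightarrow> u - v \<in> S"

definition graph_aut :: "('v \<Rightarrow> 'v \<Rightarrow> bool) \<Rightarrow> ('v \<Rightarrow> 'v) set" where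
  "graph_aut E = {\<phi>. bij \<phi> \<and> (\<forall>u v. E (\<phi> u) (\<phi> v) \<longleftrightarrow> E u v)}"

definition translation_perms :: "('a::ab_group_add \<Rightarrow> 'a) set" where
  "translation_perms = {(\<lambda>x. x + b) | b. True}"

text \<open>The semidirect product of \<open>'k ^ 'n\<close> with the multiplicative group of \<open>'k\<close>, as permutations.\<close>

definition homothety_perms :: "('k::field ^ 'n::finite \<Rightarrow> 'k ^ 'n) set" where
  "homothety_perms = {(\<lambda>x. c *s x + b) | c b. c \<noteq> 0}"

definition normalizes_perms :: "('v \<Rightarrow> 'v) \<Rightarrow> ('v \<Rightarrow> 'v) set \<Rightarrow> bool" where
  "normalizes_perms \<phi> H \<longleftrightarrow> (\<lambda>g. \<phi> \<circ> g \<circ> inv \<phi>) ` H = H"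

end

theory Submission
  imports Defs
begin

text \<open>
  Let \<open>A = Aut(\<Gamma>)\<close>, let \<open>T\<close> be the group of translations, and suppose that \<open>K\<close> is the normaliser of \<open>T\<close> in
  \<open>A\<close>. In the centraliser of a nontrivial translation the regular group \<open>T\<close> is then its own
  normaliser, which forces this centraliser to equal \<open>T\<close>. So distinct conjugates of \<open>T\<close> intersect
  trivially, and two translations are conjugate in \<open>A\<close> only if they are conjugate in \<open>K\<close>.

  The permutation representation of \<open>A\<close> is multiplicity free, and its nontrivial constituents
  correspond to the parts of a partition of the set of hyperplanes. Suppose that two hyperplanes \<open>H\<^sub>1\<close>, \<open>H\<^sub>2\<close> lie in different
  parts, with constituents \<open>\<chi>\<^sub>1\<close>, \<open>\<chi>\<^sub>2\<close>. Let \<open>\<zeta>\<^sub>i\<close> be the irreducible character of \<open>K\<close> belonging to \<open>H\<^sub>i\<close>.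
  The class function induced from \<open>\<zeta>\<^sub>1 - \<zeta>\<^sub>2\<close> has norm \<open>2\<close>, as has \<open>\<chi>\<^sub>1 - \<chi>\<^sub>2\<close>, and their inner product is
  \<open>2\<close>. So they are equal, and both parts are singletons.
  Hence either all parts are singletons, in which case the stabiliser of \<open>0\<close> fixes every hyperplane
  and therefore consists of scalars, or there is only one part, in which case \<open>\<Gamma>\<close> is complete or empty
  up to loops and every transvection is an automorphism.
\<close>

section \<open>Groups containing a regular elementary abelian subgroup\<close>

text \<open>By Bezout some multiple of \<open>a\<close> exceeds a multiple of \<open>b\<close> by
  one, and both iterates fix \<open>x\<close>. If \<open>a = 0\<close>, coprimality forces
  \<open>b = 1\<close>.\<close>

lemma funpow_eq_coprime_fixpoint:
  assumes "(f ^^ a) x = x" and "(f ^^ b) x = x" and "coprime a b"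
  shows "f x = x"
proof (cases "a = 0")
  case True
  then show ?thesis using assms by simp
next
  case False
  have mult: "(f ^^ (c * k)) x = x" if "(f ^^ c) x = x" for c k
    using that by (induction k) (simp_all add: funpow_add)
  obtain k l where "a * k = b * l + 1"
    using bezout_nat[OF False, of b] assms(3) by auto
  then have "(f ^^ (b * l + 1)) x = x"
    using mult[OF assms(1)] by metis
  moreover have "(f ^^ (b * l + 1)) x = f ((f ^^ (b * l)) x)"
    by simp
  ultimately show ?thesis
    using mult[OF assms(2)] by simp
qed

text \<open>The points moved by \<open>f\<close> split into orbits of exactly \<open>p\<close>
  elements, because a shorter period would be coprime to \<open>p\<close>. It is used below to count
  the conjugates of a regular subgroup.\<close>

lemma card_fixpoints_cong:
  assumes fin: "finite X" and p: "prime p"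
    and closed: "\<And>x. x \<in> X \<Longrightarrow> f x \<in> X"
    and per: "\<And>x. x \<in> X \<Longrightarrow> (f ^^ p) x = x"
  shows "card X mod p = card {x \<in> X. f x = x} mod p"
proof -
  define Y where "Y = {x \<in> X. f x \<noteq> x}"
  define orb where "orb = (\<lambda>x. (\<lambda>k. (f ^^ k) x) ` {..<p})"
  have p0: "0 < p" using p by (simp add: prime_gt_0_nat)
  have pow_in: "(f ^^ k) x \<in> X" if "x \<in> X" for x k
    using that closed by (induction k) auto
  have pow_mod: "(f ^^ (k mod p)) x = (f ^^ k) x" if "x \<in> X" for x k
    using funpow_mod_eq[OF per[OF that]] .
  have orbI: "(f ^^ k) x \<in> orb x" if "x \<in> X" for x k
    unfolding orb_def using pow_mod[OF that, of k] p0
    by (metis imageI lessThan_iff mod_less_divisor)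
  have ret: "(f ^^ (p - k)) ((f ^^ k) x) = x" if "x \<in> X" "k \<le> p" for x k
  proof -
    have "(f ^^ (p - k)) ((f ^^ k) x) = (f ^^ (p - k + k)) x"
      by (simp add: funpow_add)
    then show ?thesis using that per by simp
  qed
  have pow_Y: "(f ^^ k) x \<in> Y" if "x \<in> Y" for x k
  proof -
    have x: "x \<in> X" "f x \<noteq> x" using that by (auto simp: Y_def)
    have "(f ^^ k) x \<in> Y" if kp: "k < p" for k
    proof (rule ccontr)
      assume "(f ^^ k) x \<notin> Y"
      then have fx: "f ((f ^^ k) x) = (f ^^ k) x"
        using pow_in[OF x(1)] by (simp add: Y_def)
      then have fix_all: "(f ^^ m) ((f ^^ k) x) = (f ^^ k) x" for m
        by (induction m) auto
      have "x = (f ^^ k) x"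
        using ret[OF x(1), of k] kp fix_all by simp
      with fx x(2) show False by simp
    qed
    then show ?thesis using pow_mod[OF x(1), of k] p0 by (metis mod_less_divisor)
  qed
  have orb_sub: "orb x \<subseteq> Y" if "x \<in> Y" for x
    using pow_Y[OF that] by (auto simp: orb_def)
  have card_orb: "card (orb x) = p" if "x \<in> Y" for x
  proof -
    have x: "x \<in> X" "f x \<noteq> x" using that by (auto simp: Y_def)
    have ne: "(f ^^ i) x \<noteq> (f ^^ j) x" if "i < j" "j < p" for i j
    proof
      assume eq: "(f ^^ i) x = (f ^^ j) x"
      have "(f ^^ (j - i)) ((f ^^ i) x) = (f ^^ i) x"
        using eq that(1) by (metis comp_apply funpow_add le_add_diff_inverse2 less_imp_le)
      moreover have "(f ^^ p) ((f ^^ i) x) = (f ^^ i) x"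
        using per[OF pow_in[OF x(1)]] .
      moreover have "coprime (j - i) p"
        using p that prime_imp_coprime_nat[of p "j - i"] nat_dvd_not_less[of "j - i" p]
        by (auto simp: coprime_commute)
      ultimately have "f ((f ^^ i) x) = (f ^^ i) x"
        by (rule funpow_eq_coprime_fixpoint)
      then show False using pow_Y[OF \<open>x \<in> Y\<close>, of i] by (simp add: Y_def)
    qed
    have "inj_on (\<lambda>k. (f ^^ k) x) {..<p}"
      by (rule linorder_inj_onI) (auto simp: ne)
    then show ?thesis by (simp add: orb_def card_image)
  qed
  have orb_eq: "orb y = orb x" if xy: "x \<in> Y" "y \<in> orb x" for x y
  proof -
    have x: "x \<in> X" using that by (auto simp: Y_def)
    obtain k where k: "k < p" "y = (f ^^ k) x"
      using xy(2) unfolding orb_def by blast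
    have "orb y \<subseteq> orb x"
    proof
      fix w assume "w \<in> orb y"
      then obtain i where "w = (f ^^ i) y" by (auto simp: orb_def)
      then have "w = (f ^^ (i + k)) x" using k by (simp add: funpow_add)
      then show "w \<in> orb x" using orbI[OF x] by simp
    qed
    moreover have "card (orb y) = card (orb x)"
      using card_orb orb_sub that by (metis subsetD)
    ultimately show ?thesis
      by (intro card_subset_eq) (auto simp: orb_def)
  qed
  have self: "x \<in> orb x" if "x \<in> Y" for x
    using orbI[of x 0] that by (auto simp: Y_def)
  have Un: "\<Union> (orb ` Y) = Y"
    using orb_sub self by auto
  have "p dvd card (\<Union> (orb ` Y))"
  proof (rule dvd_partition)
    show "finite (\<Union> (orb ` Y))" using Un fin by (simp add: Y_def)
    show "\<forall>c\<in>orb ` Y. p dvd card c" using card_orb by auto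
    show "\<forall>c1\<in>orb ` Y. \<forall>c2\<in>orb ` Y. c1 \<noteq> c2 \<longrightarrow> c1 \<inter> c2 = {}"
      using orb_eq by blast
  qed
  then have "p dvd card Y" by (simp add: Un)
  moreover have "card X = card {x \<in> X. f x = x} + card Y"
  proof -
    have "X = {x \<in> X. f x = x} \<union> Y" by (auto simp: Y_def)
    then show ?thesis
      using fin by (metis (no_types, lifting) Y_def card_Un_disjoint disjoint_iff finite_Un mem_Collect_eq)
  qed
  ultimately show ?thesis
    by auto
qed

section \<open>Translations and groups of permutations\<close>

definition tr :: "'v::ab_group_add \<Rightarrow> 'v \<Rightarrow> 'v" where
  "tr b = (\<lambda>x. x + b)"

lemma tr_apply [simp]: "tr b x = x + b"
  by (simp add: tr_def)

lemma tr_comp [simp]: "tr a \<circ> tr b = tr (a + b)"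
  by (auto simp: algebra_simps)

lemma tr_0 [simp]: "tr 0 = id"
  by auto

lemma tr_eq_iff [simp]: "tr a = tr b \<longleftrightarrow> a = b"
  by (metis add_0 tr_apply)

lemma translation_perms_eq: "translation_perms = range tr"
  by (auto simp: translation_perms_def tr_def)

lemma bij_tr: "bij (tr b)"
  by (rule o_bij[of "tr (- b)"]) auto

lemma inv_tr [simp]: "inv (tr b) = tr (- b)"
  by (rule inv_equality) auto

locale perm_group =
  fixes C :: "('v \<Rightarrow> 'v) set"
  assumes perm_bij: "c \<in> C \<Longrightarrow> bij c"
    and id_in: "id \<in> C"
    and comp_in: "c \<in> C \<Longrightarrow> d \<in> C \<Longrightarrow> c \<circ> d \<in> C"
    and inv_in: "c \<in> C \<Longrightarrow> inv c \<in> C"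
begin

lemma inv_comp [simp]: "c \<in> C \<Longrightarrow> inv c \<circ> c = id"
  using perm_bij by (simp add: bij_is_inj)

lemma inv_apply [simp]: "c \<in> C \<Longrightarrow> inv c (c x) = x"
  using perm_bij by (simp add: bij_is_inj)

lemma apply_inv [simp]: "c \<in> C \<Longrightarrow> c (inv c x) = x"
  using perm_bij by (simp add: bij_is_surj surj_f_inv_f)

lemma conj_comp: "c \<in> C \<Longrightarrow> (c \<circ> f \<circ> inv c) \<circ> (c \<circ> g \<circ> inv c) = c \<circ> (f \<circ> g) \<circ> inv c"
  by (auto simp: fun_eq_iff)

lemma perm_group_centralizer: "perm_group {c \<in> C. c \<circ> g = g \<circ> c}"
proof
  fix c d assume c: "c \<in> {c \<in> C. c \<circ> g = g \<circ> c}"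
  then show "bij c" by (simp add: perm_bij)
  have cg: "c (g x) = g (c x)" for x using c by (auto simp: fun_eq_iff)
  show "c \<circ> d \<in> {c \<in> C. c \<circ> g = g \<circ> c}" if d: "d \<in> {c \<in> C. c \<circ> g = g \<circ> c}"
  proof -
    have "d (g x) = g (d x)" for x using d by (auto simp: fun_eq_iff)
    with cg show ?thesis using c d by (auto simp: comp_in)
  qed
  have "inv c (g x) = g (inv c x)" for x
  proof -
    have "c (g (inv c x)) = g x" using cg c by simp
    then show ?thesis using c by (metis (no_types, lifting) inv_apply mem_Collect_eq)
  qed
  then show "inv c \<in> {c \<in> C. c \<circ> g = g \<circ> c}" using c by (auto simp: inv_in)
qed (simp add: id_in)

lemma inv_comp_eq: "c \<in> C \<Longrightarrow> d \<in> C \<Longrightarrow> inv (c \<circ> d) = inv d \<circ> inv c"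
  using perm_bij by (simp add: o_inv_distrib)

end

text \<open>A sum of \<open>n\<close> equal terms serves as the integer multiple of \<open>x\<close>
  in a bare abelian group, so that exponent \<open>p\<close> can be expressed there.\<close>

lemma sum_const_add:
  fixes x :: "'v::ab_group_add"
  shows "(\<Sum>i<m + n. x) = (\<Sum>i<m. x) + (\<Sum>i<(n::nat). x)"
  by (induction n) (simp_all add: add_ac)

lemma sum_const_card:
  fixes x :: "'v::ab_group_add"
  assumes "finite X"
  shows "(\<Sum>i\<in>X. x) = (\<Sum>i<card X. x)"
  using assms by (induction X rule: finite_induct) simp_all

lemma sum_const_mod_1:
  fixes x :: "'v::ab_group_add" and p n :: nat
  assumes "(\<Sum>i<p. x) = 0" and "n mod p = 1"
  shows "(\<Sum>i<n. x) = x"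
proof -
  have "(\<Sum>i<p * k. x) = 0" for k
    by (induction k) (simp_all add: sum_const_add assms)
  moreover have "n = p * (n div p) + 1"
    using assms(2) by (metis mult_div_mod_eq)
  ultimately show ?thesis
    by (metis (no_types) add_0 lessThan_0 lessThan_Suc One_nat_def sum.empty sum_const_add
        finite.emptyI sum.insert empty_iff add.right_neutral)
qed

text \<open>Here \<open>T = range tr\<close> is a regular elementary abelian subgroup of \<open>C\<close> which is its own normaliser
  in \<open>C\<close>. This replaces an appeal to Burnside's transfer theorem. By induction, only the translations
  in \<open>Z\<close> have a centraliser larger than \<open>T\<close>; counting the conjugates of the other translations leaves
  exactly \<open>card Z * card C\<^sub>0\<close> elements of \<open>C\<close>, hence \<open>Z C\<^sub>w\<close> is the same set for all points \<open>w\<close>.\<close>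

lemma self_normalizing_translations:
  fixes C :: "('v::{ab_group_add,finite} \<Rightarrow> 'v) set"
  assumes "perm_group C" and "range tr \<subseteq> C"
    and "prime (p::nat)" and elem: "\<And>x::'v. (\<Sum>i<p. x) = 0"
    and "\<And>c. c \<in> C \<Longrightarrow> (\<And>b. c \<circ> tr b \<circ> inv c \<in> range tr) \<Longrightarrow> c \<in> range tr"
  shows "C = range tr"
  using assms(1,2,5)
proof (induction "card C" arbitrary: C rule: less_induct)
  case less
  interpret perm_group C by (rule less.prems)
  have tr_in: "tr b \<in> C" for b using less.prems(2) by auto
  have norm: "c \<in> range tr" if "c \<in> C" "\<And>b. c \<circ> tr b \<circ> inv c \<in> range tr" for c
    using less.prems(3) that by blast
  define Z where "Z = {b. \<forall>c\<in>C. c \<circ> tr b = tr b \<circ> c}"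
  have Zcomm: "c (x + z) = c x + z" if "z \<in> Z" "c \<in> C" for c x z
    using that by (auto simp: Z_def fun_eq_iff)
  \<comment> \<open>The centraliser of a noncentral translation is a proper subgroup inheriting all
    hypotheses, so the induction applies to it.\<close>
  have cent: "c \<in> range tr" if b: "b \<notin> Z" and c: "c \<in> C" "c \<circ> tr b = tr b \<circ> c" for b c
  proof -
    define D where "D = {d \<in> C. d \<circ> tr b = tr b \<circ> d}"
    have "D \<noteq> C" "D \<subseteq> C" using b by (auto simp: D_def Z_def)
    then have "card D < card C" by (simp add: psubset_card_mono psubset_eq)
    moreover have "perm_group D" unfolding D_def by (rule perm_group_centralizer)
    moreover have "range tr \<subseteq> D"
      using tr_in by (auto simp: D_def add_ac)
    moreover have "d \<in> range tr" if "d \<in> D" "\<And>a. d \<circ> tr a \<circ> inv d \<in> range tr" for d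
      using norm that by (simp add: D_def)
    ultimately have "D = range tr" by (rule less.hyps)
    then show ?thesis using c by (auto simp: D_def)
  qed
  have Zconj: "b' = b" if "c \<in> C" "c \<circ> tr b \<circ> inv c = tr b'" "b \<in> Z \<or> b' \<in> Z" for c b b'
  proof -
    have "c (x + b) = c x + b'" for x
      using that(1) fun_cong[OF that(2), of "c x"] by (simp only: comp_apply inv_apply tr_apply)
    with that Zcomm show ?thesis
      by (metis add_left_cancel perm_bij bij_is_inj injD)
  qed
  \<comment> \<open>The conjugate of \<open>range tr\<close> by \<open>c\<close> is abelian and
    contains the noncentral translation \<open>tr b'\<close>. By \<open>cent\<close> it lies in
    \<open>range tr\<close>, so \<open>c\<close> normalises the translations.\<close>
  have TI: "c \<in> range tr" if c: "c \<in> C" and b: "b \<notin> Z" and t: "c \<circ> tr b \<circ> inv c \<in> range tr" for b c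
  proof -
    obtain b' where b': "c \<circ> tr b \<circ> inv c = tr b'" using t by auto
    have "b' \<notin> Z" using Zconj[OF c b'] b by auto
    moreover have "(c \<circ> tr a \<circ> inv c) \<circ> tr b' = tr b' \<circ> (c \<circ> tr a \<circ> inv c)" for a
      unfolding b'[symmetric] conj_comp[OF c] by (simp add: add.commute)
    ultimately have "c \<circ> tr a \<circ> inv c \<in> range tr" for a
      using cent[of b' "c \<circ> tr a \<circ> inv c"] c comp_in inv_in tr_in by metis
    then show ?thesis using norm c by blast
  qed
  show ?case
  proof (cases "Z = UNIV")
    case True
    have "c \<in> range tr" if c: "c \<in> C" for c
    proof (rule norm[OF c])
      fix b
      have "c \<circ> tr b \<circ> inv c = tr b"
        using Zcomm[of b c] True c by (auto simp: fun_eq_iff)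
      then show "c \<circ> tr b \<circ> inv c \<in> range tr" by simp
    qed
    then show ?thesis using tr_in by auto
  next
    case False
    then obtain v where v: "v \<notin> Z" by auto
    define stab where "stab = (\<lambda>w. {c \<in> C. c w = w})"
    \<comment> \<open>\<open>U\<close> contains all conjugates of noncentral translations: every
      element of \<open>C\<close> is an element of \<open>stab 0\<close> followed or preceded by a
      translation, and translations commute with each other.\<close>
    define U where "U = (\<lambda>(c, b). c \<circ> tr b \<circ> inv c) ` (stab 0 \<times> - Z)"
    define P where "P = (\<lambda>w. (\<lambda>(z, c). tr z \<circ> c) ` (Z \<times> stab w))"
    have stab_tr: "c = id" if "c \<in> range tr" "c w = w" for c and w :: 'v
      using that by auto
    have eq0: "c = d" if cd: "c \<in> stab 0" "d \<in> stab 0" and t: "inv d \<circ> c \<in> range tr" for c d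
    proof -
      have "(inv d \<circ> c) 0 = 0"
        using cd inv_apply[of d 0] by (simp add: stab_def)
      then have "inv d \<circ> c = id" using stab_tr t by blast
      then have "inv d (c x) = x" for x by (simp add: fun_eq_iff)
      then have "c x = d x" for x
        using apply_inv[of d "c x"] cd by (simp add: stab_def)
      then show ?thesis by auto
    qed
    have conj_eq: "(inv d \<circ> c) \<circ> f \<circ> inv (inv d \<circ> c) = g"
      if "c \<in> C" "d \<in> C" "c \<circ> f \<circ> inv c = d \<circ> g \<circ> inv d" for c d f g
    proof -
      have "inv (inv d \<circ> c) = inv c \<circ> d"
        using that perm_bij by (simp add: inv_comp_eq inv_in inv_inv_eq)
      then have "(inv d \<circ> c) \<circ> f \<circ> inv (inv d \<circ> c) = inv d \<circ> (c \<circ> f \<circ> inv c) \<circ> d"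
        by (simp add: comp_assoc)
      also have "\<dots> = g" unfolding that(3) using that(2) by (auto simp: fun_eq_iff)
      finally show ?thesis .
    qed
    have "inj_on (\<lambda>(c, b). c \<circ> tr b \<circ> inv c) (stab 0 \<times> - Z)"
    proof (rule inj_onI, clarify)
      fix c b d b' assume cb: "c \<in> stab 0" "b \<notin> Z" "d \<in> stab 0" "b' \<notin> Z"
        and eq: "c \<circ> tr b \<circ> inv c = d \<circ> tr b' \<circ> inv d"
      have C: "c \<in> C" "d \<in> C" using cb by (auto simp: stab_def)
      have "inv d \<circ> c \<in> range tr"
        using TI[of "inv d \<circ> c" b] conj_eq[OF C eq] C cb by (simp add: comp_in inv_in)
      then have "c = d" using eq0 cb by blast
      moreover from this have "tr b = tr b'"
        using conj_eq[OF C eq] C by simp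
      ultimately show "c = d \<and> b = b'" by simp
    qed
    then have cardU: "card U = card (stab 0) * card (- Z)"
      by (simp add: U_def card_image card_cartesian_product)
    have cardC: "card C = card (stab 0) * CARD('v)"
    proof -
      have "bij_betw (\<lambda>(c, b). tr b \<circ> c) (stab 0 \<times> UNIV) C"
      proof (rule bij_betw_byWitness[where f' = "\<lambda>c. (tr (- c 0) \<circ> c, c 0)"])
        show "(\<lambda>(c, b). tr b \<circ> c) ` (stab 0 \<times> UNIV) \<subseteq> C"
          using comp_in tr_in by (auto simp: stab_def)
        show "(\<lambda>c. (tr (- c 0) \<circ> c, c 0)) ` C \<subseteq> stab 0 \<times> UNIV"
          using comp_in tr_in by (auto simp: stab_def)
      qed (auto simp: stab_def fun_eq_iff)
      then show ?thesis by (metis bij_betw_same_card card_cartesian_product)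
    qed
    have card_stab: "card (stab w) = card (stab 0)" for w
    proof -
      have "bij_betw (\<lambda>c. tr (- w) \<circ> c \<circ> tr w) (stab w) (stab 0)"
        by (rule bij_betw_byWitness[where f' = "\<lambda>c. tr w \<circ> c \<circ> tr (- w)"])
          (use comp_in tr_in in \<open>auto simp: stab_def fun_eq_iff\<close>)
      then show ?thesis by (rule bij_betw_same_card)
    qed
    have cardP: "card (P w) = card Z * card (stab 0)" for w
    proof -
      have "inj_on (\<lambda>(z, c). tr z \<circ> c) (Z \<times> stab w)"
      proof (rule inj_onI, clarify)
        fix z c z' c' assume cc: "c \<in> stab w" "c' \<in> stab w" and eq: "tr z \<circ> c = tr z' \<circ> c'"
        have eq': "c x + z = c' x + z'" for x using fun_cong[OF eq, of x] by simp
        have "z = z'" using eq'[of w] cc by (simp add: stab_def)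
        with eq' show "z = z' \<and> c = c'" by auto
      qed
      then show ?thesis by (simp add: P_def card_image card_cartesian_product card_stab[of w])
    qed
    \<comment> \<open>An element of \<open>P w\<close> moves \<open>w\<close> by some
      \<open>z\<close> in \<open>Z\<close>. If it were conjugate to \<open>tr b\<close>, then
      comparison at \<open>w\<close> would give \<open>b = z\<close>.\<close>
    have PU: "P w \<subseteq> C - U" for w
    proof clarify
      fix f assume "f \<in> P w"
      then obtain z e where f: "f = tr z \<circ> e" and ze: "z \<in> Z" "e \<in> C" "e w = w"
        by (auto simp: P_def stab_def)
      have "f \<notin> U"
      proof
        assume "f \<in> U"
        then obtain c b where cb: "c \<in> C" "b \<notin> Z" "f = c \<circ> tr b \<circ> inv c"
          by (auto simp: U_def stab_def)
        have "c (inv c w + b) = w + z"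
          using fun_cong[OF cb(3), of w] f ze by simp
        also have "\<dots> = c (inv c w + z)"
          using Zcomm[OF ze(1) cb(1), of "inv c w"] cb(1) by simp
        finally have "b = z" using cb perm_bij by (metis add_left_cancel bij_is_inj injD)
        then show False using ze cb by simp
      qed
      then show "f \<in> C - U" using f ze by (simp add: comp_in tr_in)
    qed
    have "U \<subseteq> C"
      using comp_in tr_in inv_in by (auto simp: U_def stab_def)
    then have "card (C - U) = card (stab 0) * CARD('v) - card (stab 0) * card (- Z)"
      by (simp add: card_Diff_subset cardC cardU)
    also have "\<dots> = card Z * card (stab 0)"
    proof -
      have "CARD('v) = card Z + card (- Z)"
        using card_Un_disjoint[of Z "- Z"] by (simp add: Compl_partition)
      then show ?thesis by (simp add: algebra_simps)
    qed
    finally have P_eq: "P w = C - U" for w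
      using PU cardP by (intro card_subset_eq) auto
    \<comment> \<open>Since \<open>P w = P 0\<close>, each \<open>d\<close> in \<open>stab w\<close>
      sends \<open>0\<close> into \<open>Z\<close>, so \<open>c (d 0) = c 0 + d 0\<close>. Summing
      over \<open>d\<close> and reindexing by \<open>d \<mapsto> c \<circ> d\<close> cancels
      everything but the multiple of \<open>c 0\<close>.\<close>
    have sum0: "(\<Sum>d\<in>stab w. c 0) = 0" if c: "c \<in> stab w" for c w
    proof -
      have d0: "c (d 0) = c 0 + d 0" if "d \<in> stab w" for d
      proof -
        have "tr 0 \<circ> d \<in> P w"
          unfolding P_def using that by (force simp: Z_def)
        then have "d \<in> P 0" using P_eq by (metis tr_0 id_comp)
        then have "d 0 \<in> Z" by (auto simp: P_def stab_def)
        then show ?thesis using Zcomm[of "d 0" c 0] c by (simp add: stab_def)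
      qed
      have bij': "bij_betw (\<lambda>d. c \<circ> d) (stab w) (stab w)"
        by (rule bij_betw_byWitness[where f' = "\<lambda>d. inv c \<circ> d"])
          (use c comp_in inv_in inv_apply[of c w] in \<open>auto simp: stab_def fun_eq_iff\<close>)
      have "(\<Sum>d\<in>stab w. d 0) = (\<Sum>d\<in>stab w. c (d 0))"
        using sum.reindex_bij_betw[OF bij', of "\<lambda>d. d 0"] by simp
      also have "\<dots> = (\<Sum>d\<in>stab w. c 0) + (\<Sum>d\<in>stab w. d 0)"
        using d0 by (simp add: sum.distrib)
      finally show ?thesis by simp
    qed
    \<comment> \<open>\<open>range tr\<close> has \<open>card (stab 0)\<close> conjugates in
      \<open>C\<close>. Conjugation by \<open>tr v\<close> permutes them with period dividing
      \<open>p\<close>, and by \<open>TI\<close> it fixes only \<open>range tr\<close>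
      itself.\<close>
    have card_mod: "card (stab 0) mod p = 1"
    proof -
      define cj where "cj = (\<lambda>(c :: 'v \<Rightarrow> 'v) X. (\<lambda>g :: 'v \<Rightarrow> 'v. c \<circ> g \<circ> inv c) ` X)"
      define X where "X = (\<lambda>c. cj c (range tr)) ` stab 0"
      have cj_comp: "cj c (cj d Y) = cj (c \<circ> d) Y" if "c \<in> C" "d \<in> C" for c d Y
        using that by (auto simp: cj_def image_image inv_comp_eq comp_assoc)
      have cj_tr: "cj (tr b) (range tr) = range tr" for b
        by (auto simp: cj_def image_image fun_eq_iff)
      have cj_eqD: "inv d \<circ> c \<in> range tr" if "c \<in> C" "d \<in> C" "cj c (range tr) = cj d (range tr)" for c d
      proof -
        have "c \<circ> tr v \<circ> inv c \<in> cj c (range tr)" by (simp add: cj_def)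
        then have "c \<circ> tr v \<circ> inv c \<in> cj d (range tr)" by (simp only: that(3))
        then obtain b where "c \<circ> tr v \<circ> inv c = d \<circ> tr b \<circ> inv d" by (auto simp: cj_def)
        then show ?thesis
          using TI[of "inv d \<circ> c" v] conj_eq[OF that(1,2)] that v by (simp add: comp_in inv_in)
      qed
      have "inj_on (\<lambda>c. cj c (range tr)) (stab 0)"
        using eq0 cj_eqD by (intro inj_onI) (auto simp: stab_def)
      then have cardX: "card X = card (stab 0)" by (simp add: X_def card_image)
      have X_alt: "X = (\<lambda>c. cj c (range tr)) ` C"
      proof -
        have "cj c (range tr) \<in> X" if c: "c \<in> C" for c
        proof -
          define b where "b = inv c 0"
          have "cj c (range tr) = cj (c \<circ> tr b) (range tr)"
            using cj_comp[OF c tr_in, of b "range tr"] by (simp only: cj_tr)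
          moreover have "c \<circ> tr b \<in> stab 0"
            using apply_inv[OF c, of 0] comp_in[OF c tr_in, of b] by (simp add: stab_def b_def)
          ultimately show ?thesis by (auto simp: X_def)
        qed
        then show ?thesis by (auto simp: X_def stab_def)
      qed
      have cj_fun: "(cj (tr v) ^^ n) (cj c (range tr)) = cj (tr (\<Sum>i<n. v) \<circ> c) (range tr)"
        if c: "c \<in> C" for n c
      proof (induction n)
        case (Suc n)
        have "(cj (tr v) ^^ Suc n) (cj c (range tr)) = cj (tr v) (cj (tr (\<Sum>i<n. v) \<circ> c) (range tr))"
          unfolding Suc[symmetric] by simp
        also have "\<dots> = cj (tr v \<circ> (tr (\<Sum>i<n. v) \<circ> c)) (range tr)"
          using comp_in[OF tr_in c] by (intro cj_comp tr_in)
        also have "tr v \<circ> (tr (\<Sum>i<n. v) \<circ> c) = tr (\<Sum>i<Suc n. v) \<circ> c"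
          by (auto simp: add_ac)
        finally show ?case .
      qed simp
      have "card X mod p = card {Y \<in> X. cj (tr v) Y = Y} mod p"
      proof (rule card_fixpoints_cong)
        show "(cj (tr v) ^^ p) Y = Y" if "Y \<in> X" for Y
          using that cj_fun elem by (auto simp: X_alt)
        show "cj (tr v) Y \<in> X" if "Y \<in> X" for Y
          using that cj_comp tr_in comp_in by (auto simp: X_alt)
      qed (use \<open>prime p\<close> in auto)
      also have "{Y \<in> X. cj (tr v) Y = Y} = {range tr}"
      proof -
        have "range tr \<in> X" unfolding X_alt using cj_tr[of 0] tr_in by (metis image_eqI)
        moreover have "Y = range tr" if Y: "Y \<in> X" "cj (tr v) Y = Y" for Y
        proof -
          obtain c where c: "c \<in> C" "Y = cj c (range tr)" using Y(1) unfolding X_alt by blast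
          have "cj (tr v \<circ> c) (range tr) = cj c (range tr)"
            using Y(2) unfolding c(2) cj_comp[OF tr_in c(1)] .
          then have "inv c \<circ> (tr v \<circ> c) \<in> range tr"
            using cj_eqD c comp_in tr_in by blast
          then obtain b where b: "inv c \<circ> (tr v \<circ> c) = tr b" by auto
          have "inv c \<circ> tr v \<circ> inv (inv c) = tr b"
            using b c perm_bij by (simp add: inv_inv_eq comp_assoc)
          then have "inv c \<in> range tr" using TI[of "inv c" v] v c inv_in by auto
          then obtain a where "inv c = tr a" by auto
          then have "c = tr (- a)" using c perm_bij by (metis inv_inv_eq inv_tr)
          then show ?thesis using c cj_tr by simp
        qed
        ultimately show ?thesis using cj_tr[of v] by blast
      qed
      finally show ?thesis using cardX prime_gt_1_nat[OF \<open>prime p\<close>] by simp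
    qed
    \<comment> \<open>In exponent \<open>p\<close>, a multiple of \<open>c 0\<close> by a number
      congruent to 1 is \<open>c 0\<close>, so \<open>sum0\<close> gives \<open>c 0 = 0\<close>. All
      point stabilisers then coincide, hence are trivial.\<close>
    have "c \<in> stab 0" if "c \<in> stab w" for c w
    proof -
      have "(\<Sum>d\<in>stab w. c 0) = c 0"
        using sum_const_card[of "stab w" "c 0"] sum_const_mod_1[OF elem card_mod, of "c 0"] card_stab[of w]
        by simp
      then show ?thesis using sum0[OF that] that by (simp add: stab_def)
    qed
    then have "stab w = stab 0" for w
      using card_stab[of w] by (intro card_subset_eq) auto
    then have "c = id" if "c \<in> stab 0" for c
      using that by (auto simp: stab_def fun_eq_iff)
    moreover have "tr (- c 0) \<circ> c \<in> stab 0" if "c \<in> C" for c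
      using that comp_in tr_in by (simp add: stab_def)
    ultimately have "tr (- c 0) \<circ> c = id" if "c \<in> C" for c
      using that by blast
    then have "c x = tr (c 0) x" if "c \<in> C" for c x
      using that by (simp add: fun_eq_iff algebra_simps)
    then have "c = tr (c 0)" if "c \<in> C" for c
      using that by blast
    then show ?thesis using tr_in by auto
  qed
qed

section \<open>Fourier analysis of homogeneous functions\<close>

definition conv :: "('v::{ab_group_add,finite} \<Rightarrow> real) \<Rightarrow> ('v \<Rightarrow> real) \<Rightarrow> 'v \<Rightarrow> real" where
  "conv f g z = (\<Sum>y\<in>UNIV. f (z - y) * g y)"

lemma sum_translate:
  fixes f :: "'v::{ab_group_add,finite} \<Rightarrow> real"
  shows "(\<Sum>x\<in>UNIV. f (x + b)) = (\<Sum>x\<in>UNIV. f x)"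
  using sum.reindex_bij_betw[OF bij_tr[of b], of f] by simp

lemma sum_reflect:
  fixes f :: "'v::{ab_group_add,finite} \<Rightarrow> real"
  shows "(\<Sum>x\<in>UNIV. f (b - x)) = (\<Sum>x\<in>UNIV. f x)"
proof -
  have "bij (\<lambda>x. b - x)" by (rule o_bij[of "\<lambda>x. b - x"]) auto
  from sum.reindex_bij_betw[OF this, of f] show ?thesis by simp
qed

lemma conv_commute: "conv f g = conv g f"
proof
  fix z
  have "conv f g z = (\<Sum>y\<in>UNIV. f (z - (z - y)) * g (z - y))"
    unfolding conv_def by (rule sum_reflect[symmetric, of "\<lambda>y. f (z - y) * g y" z])
  then show "conv f g z = conv g f z" by (simp add: conv_def mult.commute)
qed

lemma conv_assoc: "conv (conv f g) h = conv f (conv g h)"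
proof
  fix z
  have "conv (conv f g) h z = (\<Sum>x\<in>UNIV. \<Sum>y\<in>UNIV. f (z - x - y) * g y * h x)"
    by (simp add: conv_def sum_distrib_right)
  also have "\<dots> = (\<Sum>x\<in>UNIV. \<Sum>y\<in>UNIV. f (z - y) * g (y - x) * h x)"
  proof (rule sum.cong[OF refl])
    fix x
    show "(\<Sum>y\<in>UNIV. f (z - x - y) * g y * h x) = (\<Sum>y\<in>UNIV. f (z - y) * g (y - x) * h x)"
      using sum_translate[of "\<lambda>y. f (z - x - y) * g y * h x" "- x"] by simp
  qed
  also have "\<dots> = (\<Sum>y\<in>UNIV. \<Sum>x\<in>UNIV. f (z - y) * g (y - x) * h x)"
    by (rule sum.swap)
  also have "\<dots> = conv f (conv g h) z"
    by (simp add: conv_def sum_distrib_left mult.assoc)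
  finally show "conv (conv f g) h z = conv f (conv g h) z" .
qed

section \<open>A real-valued Fourier transform on vector spaces over finite fields\<close>

definition dotp :: "'k::field ^ 'n::finite \<Rightarrow> 'k ^ 'n \<Rightarrow> 'k" where
  "dotp a x = (\<Sum>i\<in>UNIV. a $ i * x $ i)"

lemma dotp_commute: "dotp a x = dotp x a"
  by (simp add: dotp_def mult.commute)

lemma dotp_add_right: "dotp a (x + y) = dotp a x + dotp a y"
  by (simp add: dotp_def distrib_left sum.distrib)

lemma dotp_diff_right: "dotp a (x - y) = dotp a x - dotp a y"
  by (simp add: dotp_def right_diff_distrib sum_subtractf)

lemma dotp_smult_right: "dotp a (c *s x) = c * dotp a x"
  by (simp add: dotp_def sum_distrib_left mult.left_commute)

lemma dotp_add_left: "dotp (x + y) a = dotp x a + dotp y a"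
  by (metis dotp_commute dotp_add_right)

lemma dotp_diff_left: "dotp (x - y) a = dotp x a - dotp y a"
  by (metis dotp_commute dotp_diff_right)

lemma dotp_smult_left: "dotp (c *s x) a = c * dotp x a"
  by (metis dotp_commute dotp_smult_right)

lemma dotp_0_left [simp]: "dotp 0 x = 0"
  by (simp add: dotp_def)

lemma dotp_0_right [simp]: "dotp x 0 = 0"
  by (simp add: dotp_def)

lemma dotp_axis_left: "dotp (axis i 1) x = x $ i"
proof -
  have "dotp (axis i 1) x = (\<Sum>j\<in>UNIV. if j = i then x $ j else 0)"
    unfolding dotp_def by (rule sum.cong) (auto simp: axis_def)
  then show ?thesis by simp
qed

lemma dotp_nondegenerate:
  assumes "x \<noteq> 0"
  obtains b where "dotp b x \<noteq> 0"
  using assms dotp_axis_left by (metis vec_eq_iff zero_index)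

text \<open>For \<open>a \<noteq> 0\<close> this is the average of the nontrivial additive characters of the space which are
  trivial on the hyperplane orthogonal to \<open>a\<close>. It takes rational values, so no roots of unity
  are needed for the Fourier analysis of functions which are constant on punctured lines.\<close>

definition xi :: "'k::{field,finite} ^ 'n::finite \<Rightarrow> 'k ^ 'n \<Rightarrow> real" where
  "xi a x = (if dotp a x = 0 then 1 else - 1 / (real CARD('k) - 1))"

text \<open>On homogeneous functions this is the ordinary Fourier transform, whose values there do
  not change when \<open>a\<close> is scaled.\<close>

definition hat :: "('k::{field,finite} ^ 'n::finite \<Rightarrow> real) \<Rightarrow> 'k ^ 'n \<Rightarrow> real" where
  "hat f a = (\<Sum>x\<in>UNIV. f x * xi a x)"

definition homogeneous :: "('k::field ^ 'n::finite \<Rightarrow> real) \<Rightarrow> bool" where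
  "homogeneous f \<longleftrightarrow> (\<forall>c x. c \<noteq> 0 \<longrightarrow> f (c *s x) = f x)"

lemma card_field_gt_1: "1 < real CARD('k::{field,finite})"
proof -
  have "card {0, 1 :: 'k} \<le> CARD('k)" by (rule card_mono) auto
  then show ?thesis by simp
qed

lemma xi_commute: "xi a x = xi x a"
  by (simp add: xi_def dotp_commute)

lemma xi_0_right [simp]: "xi a 0 = 1"
  by (simp add: xi_def)

lemma xi_0_left [simp]: "xi 0 x = 1"
  by (simp add: xi_def)

lemma xi_minus [simp]: "xi a (- x) = xi a x"
  using dotp_diff_right[of a 0 x] by (simp add: xi_def)

lemma xi_diff_commute: "xi a (x - y) = xi a (y - x)"
  using xi_minus[of a "x - y"] by simp

lemma homogeneous_xi: "homogeneous (xi a)"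
  by (simp add: homogeneous_def xi_def dotp_smult_right)

lemma sum_one_exception:
  fixes u v :: real
  assumes "finite X" and "t0 \<in> X"
  shows "(\<Sum>t\<in>X. if t = t0 then u else v) = u + (real (card X) - 1) * v"
proof -
  have "(\<Sum>t\<in>X. if t = t0 then u else v) = u + (\<Sum>t\<in>X - {t0}. if t = t0 then u else v)"
    using assms by (simp add: sum.remove)
  also have "(\<Sum>t\<in>X - {t0}. if t = t0 then u else v) = (\<Sum>t\<in>X - {t0}. v)"
    by (rule sum.cong) auto
  also have "\<dots> = (real (card X) - 1) * v"
    using assms card_gt_0_iff[of X] by (auto simp: card_Diff_singleton)
  finally show ?thesis .
qed

text \<open>This product formula replaces the multiplicativity of characters. When neither
  \<open>y\<close> nor \<open>z\<close> is orthogonal to \<open>a\<close>, exactly one nonzero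
  \<open>c\<close> puts \<open>z - c *s y\<close> in the hyperplane.\<close>

lemma xi_line_average:
  fixes a y z :: "'k::{field,finite} ^ 'n::finite"
  shows "(\<Sum>c\<in>- {0}. xi a (z - c *s y)) = (real CARD('k) - 1) * (xi a z * xi a y)"
proof -
  define q where "q = real CARD('k)"
  have q: "q > 1" unfolding q_def by (rule card_field_gt_1)
  have card: "real (card (- {0 :: 'k})) = q - 1"
    using q by (simp add: card_Diff_subset Compl_eq_Diff_UNIV q_def)
  show ?thesis
  proof (cases "dotp a y = 0 \<or> dotp a z = 0")
    case True
    then have "(\<Sum>c\<in>- {0 :: 'k}. xi a (z - c *s y)) = (\<Sum>c\<in>- {0 :: 'k}. xi a z * xi a y)"
      by (intro sum.cong) (auto simp: xi_def dotp_diff_right dotp_smult_right)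
    then show ?thesis using card by (simp add: q_def)
  next
    case False
    have "(\<Sum>c\<in>- {0 :: 'k}. xi a (z - c *s y)) =
        (\<Sum>c\<in>- {0 :: 'k}. if c = dotp a z / dotp a y then 1 else - 1 / (q - 1))"
      using False by (intro sum.cong) (auto simp: xi_def dotp_diff_right dotp_smult_right q_def field_simps)
    also have "\<dots> = 1 + (q - 1 - 1) * (- 1 / (q - 1))"
      using False by (subst sum_one_exception) (simp_all add: card del: of_nat_eq_iff)
    also have "\<dots> = (q - 1) * (xi a z * xi a y)"
    proof -
      obtain r where "q = r + 1" "0 < r" using q by (metis diff_gt_0_iff_gt diff_add_cancel)
      then show ?thesis using False by (simp add: xi_def q_def[symmetric] field_simps)
    qed
    finally show ?thesis by (simp add: q_def)
  qed
qed

text \<open>For \<open>x \<noteq> 0\<close> the sum already vanishes along each line of vectors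
  \<open>a\<close> in a direction \<open>b\<close> not orthogonal to \<open>x\<close>: one term is 1
  and the other \<open>q - 1\<close> terms add up to -1.\<close>

lemma sum_xi_left:
  fixes x :: "'k::{field,finite} ^ 'n::finite"
  shows "(\<Sum>a\<in>UNIV. xi a x) = (if x = 0 then real CARD('k ^ 'n) else 0)"
proof (cases "x = 0")
  case False
  then obtain b where b: "dotp b x \<noteq> 0" by (rule dotp_nondegenerate)
  define q where "q = real CARD('k)"
  have q: "q > 1" unfolding q_def by (rule card_field_gt_1)
  have line: "(\<Sum>t\<in>UNIV. xi (a + t *s b) x) = 0" for a
  proof -
    have "(\<Sum>t\<in>UNIV. xi (a + t *s b) x) = (\<Sum>t\<in>UNIV. if t = - dotp a x / dotp b x then 1 else - 1 / (q - 1))"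
      using b by (intro sum.cong)
        (auto simp: xi_def dotp_add_left dotp_smult_left q_def field_simps add_eq_0_iff2)
    also have "\<dots> = 1 + (q - 1) * (- 1 / (q - 1))"
      by (subst sum_one_exception) (simp_all add: q_def)
    also have "\<dots> = 0" using q by simp
    finally show ?thesis .
  qed
  have "q * (\<Sum>a\<in>UNIV. xi a x) = (\<Sum>t\<in>(UNIV :: 'k set). \<Sum>a\<in>UNIV. xi (a + t *s b) x)"
    using sum_translate[of "\<lambda>a. xi a x"] by (simp add: q_def)
  also have "\<dots> = (\<Sum>a\<in>UNIV. \<Sum>t\<in>UNIV. xi (a + t *s b) x)"
    by (rule sum.swap)
  also have "\<dots> = 0" by (simp add: line)
  finally show ?thesis using False q by simp
qed simp

lemma sum_homogeneous_scale:
  fixes f g :: "'k::{field,finite} ^ 'n::finite \<Rightarrow> real"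
  assumes "homogeneous f" and "c \<noteq> 0"
  shows "(\<Sum>x\<in>UNIV. f x * g (c *s x)) = (\<Sum>x\<in>UNIV. f x * g x)"
proof -
  have "bij ((*s) c)"
    by (rule o_bij[of "(*s) (inverse c)"]) (use assms(2) in auto)
  from sum.reindex_bij_betw[OF this, of "\<lambda>x. f x * g x"] show ?thesis
    using assms by (simp add: homogeneous_def)
qed

text \<open>The functions \<open>xi a\<close> are common eigenfunctions of all convolutions with
  homogeneous functions. Homogeneity allows averaging over the scalings of \<open>y\<close>, after
  which the product formula applies.\<close>

lemma conv_xi:
  fixes a :: "'k::{field,finite} ^ 'n::finite"
  assumes "homogeneous f"
  shows "conv f (xi a) z = hat f a * xi a z"
proof -
  define q where "q = real CARD('k)"
  have q: "q > 1" unfolding q_def by (rule card_field_gt_1)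
  have card: "real (card (- {0 :: 'k})) = q - 1"
    using q by (simp add: card_Diff_subset Compl_eq_Diff_UNIV q_def)
  have "conv f (xi a) z = (\<Sum>y\<in>UNIV. f y * xi a (z - y))"
    by (subst conv_commute) (simp add: conv_def mult.commute)
  then have "(q - 1) * conv f (xi a) z = (\<Sum>c\<in>- {0 :: 'k}. \<Sum>y\<in>UNIV. f y * xi a (z - y))"
    by (simp add: card)
  also have "\<dots> = (\<Sum>c\<in>- {0 :: 'k}. \<Sum>y\<in>UNIV. f y * xi a (z - c *s y))"
  proof (rule sum.cong[OF refl])
    fix c :: 'k assume "c \<in> - {0}"
    then show "(\<Sum>y\<in>UNIV. f y * xi a (z - y)) = (\<Sum>y\<in>UNIV. f y * xi a (z - c *s y))"
      using sum_homogeneous_scale[OF assms, of c "\<lambda>y. xi a (z - y)"] by simp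
  qed
  also have "\<dots> = (\<Sum>y\<in>UNIV. f y * (\<Sum>c\<in>- {0 :: 'k}. xi a (z - c *s y)))"
    by (subst sum.swap) (simp add: sum_distrib_left)
  also have "\<dots> = (q - 1) * (hat f a * xi a z)"
    unfolding xi_line_average hat_def q_def
    by (simp add: sum_distrib_left sum_distrib_right mult_ac)
  finally show ?thesis using q by simp
qed

lemma hat_eq_conv: "hat f a = conv f (xi a) 0"
  using sum_reflect[of "\<lambda>x. f x * xi a x" 0] by (simp add: hat_def conv_def)

lemma hat_conv:
  assumes "homogeneous f" and "homogeneous g"
  shows "hat (conv f g) a = hat f a * hat g a"
proof -
  have "conv g (xi a) = (\<lambda>z. hat g a * xi a z)"
    using conv_xi[OF assms(2)] by blast
  then have "hat (conv f g) a = conv f (\<lambda>z. hat g a * xi a z) 0"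
    by (simp add: hat_eq_conv conv_assoc)
  also have "\<dots> = hat g a * conv f (xi a) 0"
    by (simp add: conv_def sum_distrib_left mult_ac)
  finally show ?thesis by (simp add: hat_eq_conv)
qed

lemma fourier_inversion:
  fixes f :: "'k::{field,finite} ^ 'n::finite \<Rightarrow> real"
  assumes "homogeneous f"
  shows "real CARD('k ^ 'n) * f x = (\<Sum>a\<in>UNIV. hat f a * xi a x)"
proof -
  have "(\<Sum>a\<in>UNIV. hat f a * xi a x) = (\<Sum>a\<in>UNIV. \<Sum>y\<in>UNIV. f (x - y) * xi a y)"
    by (simp flip: conv_xi[OF assms] add: conv_def)
  also have "\<dots> = (\<Sum>y\<in>UNIV. f (x - y) * (\<Sum>a\<in>UNIV. xi a y))"
    by (subst sum.swap) (simp add: sum_distrib_left)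
  also have "\<dots> = (\<Sum>y\<in>(UNIV :: ('k ^ 'n) set). if y = 0 then f x * real CARD('k ^ 'n) else 0)"
    unfolding sum_xi_left by (rule sum.cong) simp_all
  finally show ?thesis by simp
qed

lemma hat_inject:
  fixes f g :: "'k::{field,finite} ^ 'n::finite \<Rightarrow> real"
  assumes "homogeneous f" and "homogeneous g" and "\<And>a. hat f a = hat g a"
  shows "f = g"
proof
  fix x
  have "real CARD('k ^ 'n) * f x = real CARD('k ^ 'n) * g x"
    by (simp only: fourier_inversion[OF assms(1)] fourier_inversion[OF assms(2)] assms(3))
  then show "f x = g x" by simp
qed

lemma hat_xi_commute: "hat (xi a) b = hat (xi b) a"
  by (simp add: hat_def mult.commute)

text \<open>By commutativity \<open>conv (xi a) (xi b)\<close> is the same multiple of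
  \<open>xi a\<close> and of \<open>xi b\<close>, so this multiple is zero when they differ.\<close>

lemma hat_xi_orthogonal:
  assumes "xi a \<noteq> xi b"
  shows "hat (xi a) b = 0"
proof (rule ccontr)
  assume "hat (xi a) b \<noteq> 0"
  moreover have "hat (xi a) b * xi b z = hat (xi a) b * xi a z" for z
    using conv_xi[OF homogeneous_xi, of a b z] conv_xi[OF homogeneous_xi, of b a z]
    by (simp add: conv_commute hat_xi_commute)
  ultimately show False using assms by auto
qed

lemma hat_xi_nonneg: "0 \<le> hat (xi a) b"
proof (cases "xi a = xi b")
  case True
  then show ?thesis by (simp add: hat_def sum_nonneg)
qed (simp add: hat_xi_orthogonal)

lemma sum_hat_xi:
  fixes b :: "'k::{field,finite} ^ 'n::finite"
  shows "(\<Sum>a\<in>UNIV. hat (xi a) b) = real CARD('k ^ 'n)"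
proof -
  have "(\<Sum>a\<in>UNIV. hat (xi a) b) = (\<Sum>x\<in>UNIV. (\<Sum>a\<in>UNIV. xi a x) * xi b x)"
    unfolding hat_def by (subst sum.swap) (simp add: sum_distrib_right)
  also have "\<dots> = (\<Sum>x\<in>(UNIV :: ('k ^ 'n) set). if x = 0 then real CARD('k ^ 'n) else 0)"
    unfolding sum_xi_left by (rule sum.cong) simp_all
  finally show ?thesis by simp
qed

text \<open>The two values of \<open>xi a\<close> are the roots of a quadratic equation, which
  reduces the sum of squares to the sum of \<open>xi a\<close> itself.\<close>

lemma hat_xi_self:
  fixes a :: "'k::{field,finite} ^ 'n::finite"
  assumes "a \<noteq> 0"
  shows "(real CARD('k) - 1) * hat (xi a) a = real CARD('k ^ 'n)"
proof -
  define q where "q = real CARD('k)"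
  have q: "q > 1" unfolding q_def by (rule card_field_gt_1)
  have "(q - 1) * (xi a x * xi a x) = 1 + (q - 2) * xi a x" for x
  proof -
    obtain r where "q = r + 1" "0 < r" using q by (metis diff_gt_0_iff_gt diff_add_cancel)
    then show ?thesis by (simp add: xi_def q_def[symmetric] field_simps)
  qed
  then have "(q - 1) * hat (xi a) a = (\<Sum>x\<in>UNIV. 1 + (q - 2) * xi a x)"
    by (simp add: hat_def sum_distrib_left)
  also have "\<dots> = real CARD('k ^ 'n) + (q - 2) * (\<Sum>x\<in>UNIV. xi x a)"
    by (simp add: sum.distrib sum_distrib_left xi_commute[of a])
  finally show ?thesis using assms by (simp add: sum_xi_left q_def)
qed

text \<open>Convolution is matrix multiplication of kernels that depend only on the difference of
  their arguments.\<close>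

lemma conv_shift:
  fixes w v :: "'v::{ab_group_add,finite}"
  shows "(\<Sum>u\<in>UNIV. f (w - u) * g (u - v)) = conv f g (w - v)"
  using sum_translate[of "\<lambda>u. f (w - u) * g (u - v)" v]
  by (simp add: conv_def algebra_simps)

lemma sum_over_differences:
  fixes f :: "'v::{ab_group_add,finite} \<Rightarrow> real"
  shows "(\<Sum>x\<in>UNIV. \<Sum>y\<in>UNIV. f (x - y)) = real CARD('v) * (\<Sum>z\<in>UNIV. f z)"
  by (simp add: sum_reflect)

section \<open>Dilatations\<close>

lemma dotp_orthogonal_imp_multiple:
  assumes "x \<noteq> 0" and "\<And>a. dotp a x = 0 \<Longrightarrow> dotp a y = 0"
  obtains k where "y = k *s x"
proof -
  obtain i where i: "x $ i \<noteq> 0" using assms(1) by (auto simp: vec_eq_iff)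
  have "y = (y $ i / x $ i) *s x"
  proof (rule vec_eq_iff[THEN iffD2, rule_format])
    fix j
    \<comment> \<open>This vector is chosen to be orthogonal to \<open>x\<close>. Its orthogonality
      to \<open>y\<close> is the proportionality of the coordinates \<open>i\<close> and
      \<open>j\<close>.\<close>
    have "dotp (x $ i *s axis j 1 - x $ j *s axis i 1) z = x $ i * z $ j - x $ j * z $ i" for z
      by (simp add: dotp_diff_left dotp_smult_left dotp_axis_left)
    then have "x $ i * y $ j - x $ j * y $ i = 0"
      using assms(2)[of "x $ i *s axis j 1 - x $ j *s axis i 1"] by (simp add: mult.commute)
    then show "y $ j = ((y $ i / x $ i) *s x) $ j"
      using i by (simp add: field_simps)
  qed
  then show thesis by (rule that)
qed

lemma exists_not_multiple:
  fixes u :: "'k::field ^ 'n::finite"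
  assumes "2 \<le> CARD('n)"
  obtains w where "\<And>k. w \<noteq> k *s u"
proof -
  obtain i j :: 'n where ij: "i \<noteq> j"
    using assms card_le_Suc0_iff_eq[of "UNIV :: 'n set"] by auto
  have "(\<forall>k. axis i 1 \<noteq> k *s u) \<or> (\<forall>k. axis j 1 \<noteq> k *s u)"
  proof (rule ccontr)
    assume "\<not> ?thesis"
    then obtain k l where k: "axis i 1 = k *s u" and l: "axis j 1 = l *s u" by auto
    have "1 = k * u $ i" "0 = k * u $ j" "1 = l * u $ j"
      using k l ij by (auto simp: vec_eq_iff axis_def split: if_splits)
    then show False by auto
  qed
  then show thesis using that by blast
qed

text \<open>Each vector is an eigenvector. Comparing coefficients in the difference of two
  independent vectors shows that their factors agree, and dependent vectors are compared through a
  third one outside their line.\<close>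

lemma central_dilatation_is_scaling:
  fixes g :: "'k::field ^ 'n::finite \<Rightarrow> 'k ^ 'n"
  assumes dim: "2 \<le> CARD('n)" and g0: "g 0 = 0"
    and par: "\<And>u v. \<exists>k. g u - g v = k *s (u - v)"
  obtains k where "g = (*s) k"
proof -
  have "\<exists>k. g u = k *s u" for u using par[of u 0] g0 by simp
  then obtain l where l: "g u = l u *s u" for u by metis
  have indep: "l v = l u" if u: "u \<noteq> 0" and ne: "\<And>k. v \<noteq> k *s u" for u v
  proof -
    obtain m where "g u - g v = m *s (u - v)" using par by blast
    then have eq: "(l u - m) *s u = (l v - m) *s v"
      by (simp add: l algebra_simps)
    have "l v = m"
    proof (rule ccontr)
      assume "l v \<noteq> m"
      then have "inverse (l v - m) * (l v - m) = 1" by simp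
      then have "v = inverse (l v - m) *s ((l v - m) *s v)"
        by (simp only: vector_smult_assoc vector_smult_lid)
      also have "\<dots> = (inverse (l v - m) * (l u - m)) *s u"
        by (simp only: eq[symmetric] vector_smult_assoc)
      finally show False using ne by blast
    qed
    moreover from this have "l u = m" using eq u by simp
    ultimately show ?thesis by simp
  qed
  obtain u :: "'k ^ 'n" where u: "u \<noteq> 0" by (metis zero_neq_one)
  obtain w where w: "\<And>k. w \<noteq> k *s u" using exists_not_multiple[OF dim] by blast
  have "g x = l u *s x" for x
  proof (cases "x = 0")
    case False
    have "l x = l u"
    proof (cases "\<exists>k. x = k *s u")
      case True
      then have "w \<noteq> c *s x" for c using w by (metis vector_smult_assoc)
      then have "l w = l x" using indep False by blast
      then show ?thesis using indep[OF u, of w] w by simp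
    next
      case False
      then show ?thesis using indep u by blast
    qed
    then show ?thesis using l by simp
  qed (simp add: g0)
  then show thesis using that by blast
qed

section \<open>The algebra of invariant functions\<close>

text \<open>\<open>A\<close> models the automorphism group when alternative (ii) fails. The graph
  itself does not enter the argument until the end.\<close>

locale homothety_overgroup = perm_group A
  for A :: "('k::{field,finite} ^ 'n::finite \<Rightarrow> 'k ^ 'n) set" +
  assumes homothety_subset: "homothety_perms \<subseteq> A"
    and normalizer: "\<phi> \<in> A \<Longrightarrow> normalizes_perms \<phi> translation_perms \<Longrightarrow> \<phi> \<in> homothety_perms"
begin

lemma tr_in: "tr b \<in> A"
proof -
  have "tr b = (\<lambda>x. 1 *s x + b)" by auto
  then have "tr b \<in> homothety_perms" unfolding homothety_perms_def by fastforce
  then show ?thesis using homothety_subset by auto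
qed

lemma scale_in: "c \<noteq> 0 \<Longrightarrow> (*s) c \<in> A"
proof -
  assume "c \<noteq> 0"
  moreover have "(*s) c = (\<lambda>x. c *s x + 0)" by auto
  ultimately have "(*s) c \<in> homothety_perms" unfolding homothety_perms_def by blast
  then show ?thesis using homothety_subset by auto
qed

text \<open>Conjugation is injective and the translations are finite in number, so mapping them into
  themselves already means normalising them.\<close>

lemma homothetyI:
  assumes c: "c \<in> A" and t: "\<And>b. c \<circ> tr b \<circ> inv c \<in> range tr"
  shows "c \<in> homothety_perms"
proof (rule normalizer[OF c])
  have "inj_on (\<lambda>g. c \<circ> g \<circ> inv c) (range tr)"
  proof (rule inj_onI)
    fix g h assume eq: "c \<circ> g \<circ> inv c = c \<circ> h \<circ> inv c"
    have "c (g x) = c (h x)" for x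
      using fun_cong[OF eq, of "c x"] c by simp
    then show "g = h" using inv_apply[OF c] by (metis ext)
  qed
  moreover have "(\<lambda>g. c \<circ> g \<circ> inv c) ` range tr \<subseteq> range tr" using t by blast
  ultimately have "(\<lambda>g. c \<circ> g \<circ> inv c) ` range tr = range tr"
    by (intro endo_inj_surj) auto
  then show "normalizes_perms c translation_perms"
    by (simp add: normalizes_perms_def translation_perms_eq)
qed

lemma centralizer_translation:
  assumes c: "c \<in> A" "c \<circ> tr b = tr b \<circ> c" and b: "b \<noteq> 0"
  shows "c \<in> range tr"
proof -
  define D where "D = {c \<in> A. c \<circ> tr b = tr b \<circ> c}"
  have "D = range tr"
  proof (rule self_normalizing_translations)
    show "perm_group D" unfolding D_def by (rule perm_group_centralizer)
    show "range tr \<subseteq> D" using tr_in by (auto simp: D_def add_ac)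
    show "prime CHAR('k)"
      using prime_CHAR_semidom finite_imp_CHAR_pos by (metis finite)
    show "(\<Sum>i<CHAR('k). x) = 0" for x :: "'k ^ 'n"
    proof -
      have "(\<Sum>i<CHAR('k). x) $ j = of_nat CHAR('k) * x $ j" for j
        by (subst sum_component) simp
      then show ?thesis by (simp add: vec_eq_iff del: sum_constant)
    qed
    fix d assume d: "d \<in> D" and "\<And>a. d \<circ> tr a \<circ> inv d \<in> range tr"
    then have "d \<in> homothety_perms" by (intro homothetyI) (auto simp: D_def)
    then obtain k a where ka: "d = (\<lambda>x. k *s x + a)"
      by (auto simp: homothety_perms_def)
    \<comment> \<open>A homothety commuting with a nontrivial translation fixes the vector
      \<open>b\<close> under its linear part, so its scalar factor is 1.\<close>
    have "(d \<circ> tr b) 0 = (tr b \<circ> d) 0" using d by (simp add: D_def)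
    then have "k *s b = 1 *s b" by (simp add: ka add.commute)
    then have "k = 1" using b by (metis vector_mul_rcancel)
    then have "d = tr a" by (auto simp: ka)
    then show "d \<in> range tr" by simp
  qed
  then show ?thesis using c by (auto simp: D_def)
qed

text \<open>The conjugated translations all commute with the nontrivial translation
  \<open>tr b'\<close>, hence are translations. This is the trivial intersection property of the
  conjugates of the translation group.\<close>

lemma translation_conj_homothety:
  assumes c: "c \<in> A" and b: "b \<noteq> 0" and t: "c \<circ> tr b \<circ> inv c \<in> range tr"
  shows "c \<in> homothety_perms"
proof (rule homothetyI[OF c])
  fix a
  obtain b' where b': "c \<circ> tr b \<circ> inv c = tr b'" using t by auto
  have "b' \<noteq> 0"
  proof
    assume "b' = 0"
    then have "c (0 + b) = c 0" using fun_cong[OF b', of "c 0"] c by simp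
    then have "b = 0" using inv_apply[OF c] by (metis add_0)
    then show False using b by simp
  qed
  moreover have "(c \<circ> tr a \<circ> inv c) \<circ> tr b' = tr b' \<circ> (c \<circ> tr a \<circ> inv c)"
    unfolding b'[symmetric] conj_comp[OF c] by (simp add: add.commute)
  ultimately show "c \<circ> tr a \<circ> inv c \<in> range tr"
    using centralizer_translation c comp_in inv_in tr_in by metis
qed

text \<open>These are the kernels constant on the orbits of \<open>A\<close> on pairs of points.
  Since \<open>A\<close> contains the translations, such a kernel depends only on the
  difference.\<close>

definition invariant :: "('k ^ 'n \<Rightarrow> real) \<Rightarrow> bool" where
  "invariant f \<longleftrightarrow> (\<forall>c\<in>A. \<forall>u v. f (c u - c v) = f (u - v))"

lemma invariantD: "invariant f \<Longrightarrow> c \<in> A \<Longrightarrow> f (c u - c v) = f (u - v)"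
  by (simp add: invariant_def)

lemma invariant_homogeneous:
  assumes "invariant f"
  shows "homogeneous f"
  unfolding homogeneous_def
proof (intro allI impI)
  fix k x assume "(k :: 'k) \<noteq> 0"
  then show "f (k *s x) = f x"
    using invariantD[OF assms scale_in, of k x 0] by simp
qed

lemma invariant_conv:
  assumes f: "invariant f" and g: "invariant g"
  shows "invariant (conv f g)"
  unfolding invariant_def
proof (intro ballI allI)
  fix c u v assume c: "c \<in> A"
  have "conv f g (c u - c v) = (\<Sum>t\<in>UNIV. f (c u - t) * g (t - c v))"
    by (rule conv_shift[symmetric])
  also have "\<dots> = (\<Sum>t\<in>UNIV. f (c u - c t) * g (c t - c v))"
    using sum.reindex_bij_betw[OF perm_bij[OF c], of "\<lambda>t. f (c u - t) * g (t - c v)"] by simp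
  also have "\<dots> = conv f g (u - v)"
    using f g c by (simp add: invariantD conv_shift)
  finally show "conv f g (c u - c v) = conv f g (u - v)" .
qed

lemma invariant_delta: "invariant (\<lambda>x. if x = 0 then 1 else 0)"
  by (auto simp: invariant_def) (metis inv_apply)

lemma invariant_linear: "invariant f \<Longrightarrow> invariant g \<Longrightarrow> invariant (\<lambda>x. s * f x + t * g x)"
  by (simp add: invariant_def)

lemma hat_linear: "hat (\<lambda>x. s * f x + t * g x) a = s * hat f a + t * hat g a"
  by (simp add: hat_def sum.distrib sum_distrib_left algebra_simps)

lemma hat_delta: "hat (\<lambda>x :: 'k ^ 'n. if x = 0 then 1 else 0) a = 1"
proof -
  have "hat (\<lambda>x :: 'k ^ 'n. if x = 0 then 1 else 0) a = (\<Sum>x\<in>(UNIV :: ('k ^ 'n) set). if x = 0 then 1 else 0)"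
    unfolding hat_def by (rule sum.cong) auto
  then show ?thesis by simp
qed

text \<open>Each \<open>a\<close> gives a multiplicative functional
  \<open>f \<mapsto> hat f a\<close> on the algebra of invariant functions; a class collects the
  vectors that give the same functional.\<close>

definition cls :: "'k ^ 'n \<Rightarrow> ('k ^ 'n) set" where
  "cls a = {b. \<forall>f. invariant f \<longrightarrow> hat f b = hat f a}"

lemma cls_self [simp]: "a \<in> cls a"
  by (simp add: cls_def)

lemma cls_eq: "b \<in> cls a \<Longrightarrow> cls b = cls a"
  by (auto simp: cls_def)

text \<open>The primitive idempotents of the convolution algebra of invariant functions.\<close>

definition idem :: "'k ^ 'n \<Rightarrow> 'k ^ 'n \<Rightarrow> real" where
  "idem a x = (\<Sum>b\<in>cls a. xi b x) / real CARD('k ^ 'n)"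

lemma hat_idem: "hat (idem a) c = (if c \<in> cls a then 1 else 0)"
proof -
  have "hat (idem a) c = (\<Sum>x\<in>UNIV. \<Sum>b\<in>cls a. xi b x * xi c x) / real CARD('k ^ 'n)"
    unfolding hat_def idem_def by (simp add: sum_distrib_right sum_divide_distrib)
  then have "real CARD('k ^ 'n) * hat (idem a) c = (\<Sum>x\<in>UNIV. \<Sum>b\<in>cls a. xi b x * xi c x)"
    by simp
  also have "\<dots> = (\<Sum>b\<in>cls a. hat (xi b) c)"
    by (subst sum.swap) (simp add: hat_def)
  also have "\<dots> = (\<Sum>b\<in>UNIV. if c \<in> cls a then hat (xi b) c else 0)"
  proof (rule sum.mono_neutral_cong_left)
    \<comment> \<open>Only vectors \<open>b\<close> with \<open>xi b = xi c\<close> contribute, and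
      these share the class of \<open>c\<close>. So the sum over \<open>cls a\<close> is either the
      full sum or zero.\<close>
    have *: "b \<in> cls a \<longleftrightarrow> c \<in> cls a" if "hat (xi b) c \<noteq> 0" for b
    proof -
      have "xi b = xi c" using hat_xi_orthogonal that by blast
      then show ?thesis by (simp add: cls_def hat_def)
    qed
    then show "\<forall>b\<in>UNIV - cls a. (if c \<in> cls a then hat (xi b) c else 0) = 0" by auto
    show "\<And>b. b \<in> cls a \<Longrightarrow> hat (xi b) c = (if c \<in> cls a then hat (xi b) c else 0)"
      using * by auto
  qed auto
  also have "\<dots> = real CARD('k ^ 'n) * (if c \<in> cls a then 1 else 0)"
    using sum_hat_xi[of c] by simp
  finally show ?thesis by (simp only: mult_cancel_left) simp
qed

lemma homogeneous_idem: "homogeneous (idem a)"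
  by (simp add: homogeneous_def idem_def homogeneous_xi[unfolded homogeneous_def, rule_format])

lemma idem_minus: "idem a (x - y) = idem a (y - x)"
  by (simp add: idem_def xi_diff_commute[of _ x])

lemma idem_0: "idem a 0 = real (card (cls a)) / real CARD('k ^ 'n)"
  by (simp add: idem_def)

lemma idem_0_pos: "idem a 0 > 0"
proof -
  have "card (cls a) > 0" using cls_self by (metis card_gt_0_iff empty_iff finite)
  then show ?thesis by (simp add: idem_0)
qed

text \<open>As in Lagrange interpolation, a separating invariant function is normalised for each
  \<open>b\<close> and these are multiplied. The unit is the delta function and the product is
  convolution.\<close>

lemma invariant_interpolation:
  assumes "finite B" and "B \<inter> cls a = {}"
  shows "\<exists>g. invariant g \<and> hat g a = 1 \<and> (\<forall>b\<in>B. hat g b = 0)"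
  using assms
proof (induction B rule: finite_induct)
  case empty
  show ?case using invariant_delta hat_delta by blast
next
  case (insert b B)
  then obtain g where g: "invariant g" "hat g a = 1" "\<forall>b\<in>B. hat g b = 0" by auto
  from insert.prems obtain f where f: "invariant f" "hat f b \<noteq> hat f a"
    by (auto simp: cls_def)
  define d where "d = hat f a - hat f b"
  have d: "d \<noteq> 0" using f by (simp add: d_def)
  define h where "h = (\<lambda>x. 1 / d * f x + (- hat f b / d) * (if x = 0 then 1 else 0))"
  have h: "invariant h" unfolding h_def by (intro invariant_linear f invariant_delta)
  have hat_h: "hat h x = 1 / d * hat f x + (- hat f b / d)" for x
    unfolding h_def hat_linear hat_delta by simp
  have conv: "hat (conv g h) x = hat g x * hat h x" for x
    using g h by (simp add: hat_conv invariant_homogeneous)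
  have "hat h b = 0" "hat h a = 1"
    using d by (simp_all add: hat_h d_def flip: diff_divide_distrib)
  then show ?case
    using g h invariant_conv[of g h] by (intro exI[of _ "conv g h"]) (auto simp: conv)
qed

text \<open>The function interpolating 1 on \<open>cls a\<close> and 0 elsewhere is invariant and
  has the same transform.\<close>

lemma invariant_idem: "invariant (idem a)"
proof -
  obtain g where g: "invariant g" "hat g a = 1" "\<forall>b\<in>- cls a. hat g b = 0"
    using invariant_interpolation[of "- cls a" a] by auto
  have "hat g b = hat (idem a) b" for b
    using g by (auto simp: hat_idem cls_def)
  then have "g = idem a"
    using g by (intro hat_inject) (auto simp: invariant_homogeneous homogeneous_idem)
  then show ?thesis using g by simp
qed

lemma conv_idem:
  assumes "homogeneous f" and "\<And>c. c \<in> cls b \<Longrightarrow> hat f c = t"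
  shows "conv f (idem b) = (\<lambda>z. t * idem b z)"
proof
  fix z
  have "conv f (idem b) z = (\<Sum>y\<in>UNIV. \<Sum>c\<in>cls b. f (z - y) * xi c y) / real CARD('k ^ 'n)"
    by (simp add: conv_def idem_def sum_distrib_left sum_divide_distrib)
  also have "\<dots> = (\<Sum>c\<in>cls b. conv f (xi c) z) / real CARD('k ^ 'n)"
    by (subst sum.swap) (simp add: conv_def)
  also have "\<dots> = t * idem b z"
    using assms by (simp add: conv_xi idem_def sum_distrib_left)
  finally show "conv f (idem b) z = t * idem b z" .
qed

lemma conv_idem_idem:
  "conv (idem a) (idem b) = (\<lambda>z. if cls a = cls b then idem b z else 0)"
proof -
  have "hat (idem a) c = (if cls a = cls b then 1 else 0)" if "c \<in> cls b" for c
  proof -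
    have "c \<in> cls a \<longleftrightarrow> cls a = cls b"
      using cls_eq[OF that] cls_eq[of c a] cls_self[of c] by metis
    then show ?thesis by (simp add: hat_idem)
  qed
  from conv_idem[OF homogeneous_idem this] show ?thesis
    by (cases "cls a = cls b") auto
qed

lemma conv_idem_invariant_idem:
  assumes "invariant r"
  shows "conv (conv (idem a) r) (idem b) = (\<lambda>z. if cls a = cls b then hat r b * idem b z else 0)"
proof -
  have "conv r (idem b) = (\<lambda>z. hat r b * idem b z)"
    using assms by (intro conv_idem invariant_homogeneous) (auto simp: cls_def)
  then have "conv (conv (idem a) r) (idem b) = (\<lambda>z. hat r b * conv (idem a) (idem b) z)"
    by (auto simp: conv_assoc conv_def[of "idem a"] sum_distrib_left mult_ac)
  then show ?thesis
    by (cases "cls a = cls b") (simp_all add: conv_idem_idem)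
qed

lemma hat_eq_sum_idem:
  assumes "invariant r"
  shows "(\<Sum>z\<in>UNIV. r z * idem b z) = hat r b * idem b 0"
proof -
  have "(\<Sum>z\<in>UNIV. r z * idem b z) = conv r (idem b) 0"
    using sum_reflect[of "\<lambda>z. r z * idem b z" 0] idem_minus[of b _ 0] by (simp add: conv_def)
  also have "conv r (idem b) = (\<lambda>z. hat r b * idem b z)"
    using assms by (intro conv_idem invariant_homogeneous) (auto simp: cls_def)
  finally show ?thesis .
qed

text \<open>The number of elements of the group which map \<open>(x, y)\<close> to a given pair of points with
  difference \<open>z\<close>.\<close>

definition transporter :: "'k ^ 'n \<Rightarrow> 'k ^ 'n \<Rightarrow> 'k ^ 'n \<Rightarrow> real" where
  "transporter x y z = real (card {c \<in> A. c x = z \<and> c y = 0})"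

lemma card_transporter: "real (card {c \<in> A. c x = u \<and> c y = v}) = transporter x y (u - v)"
proof -
  have "bij_betw (\<lambda>c. tr (- v) \<circ> c) {c \<in> A. c x = u \<and> c y = v} {c \<in> A. c x = u - v \<and> c y = 0}"
    by (rule bij_betw_byWitness[where f' = "\<lambda>c. tr v \<circ> c"])
      (use comp_in tr_in in \<open>auto simp: fun_eq_iff\<close>)
  then show ?thesis by (simp add: transporter_def bij_betw_same_card)
qed

lemma invariant_transporter: "invariant (transporter x y)"
  unfolding invariant_def
proof (intro ballI allI)
  fix d u v assume d: "d \<in> A"
  have "bij_betw (\<lambda>c. d \<circ> c) {c \<in> A. c x = u \<and> c y = v} {c \<in> A. c x = d u \<and> c y = d v}"
    by (rule bij_betw_byWitness[where f' = "\<lambda>c. inv d \<circ> c"])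
      (use d comp_in inv_in in \<open>auto simp: fun_eq_iff\<close>)
  then show "transporter x y (d u - d v) = transporter x y (u - v)"
    unfolding card_transporter[symmetric] by (simp add: bij_betw_same_card)
qed

lemma sum_over_group:
  fixes H :: "'k ^ 'n \<Rightarrow> 'k ^ 'n \<Rightarrow> real"
  shows "(\<Sum>c\<in>A. H (c x) (c y)) = (\<Sum>u\<in>UNIV. \<Sum>v\<in>UNIV. transporter x y (u - v) * H u v)"
proof -
  have "(\<Sum>c\<in>A. H (c x) (c y)) =
      (\<Sum>p\<in>UNIV. \<Sum>c\<in>{c \<in> A. (c x, c y) = p}. H (c x) (c y))"
    by (rule sum.group[symmetric]) auto
  also have "\<dots> = (\<Sum>p\<in>UNIV. transporter x y (fst p - snd p) * H (fst p) (snd p))"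
  proof (rule sum.cong[OF refl])
    fix p :: "('k ^ 'n) \<times> ('k ^ 'n)"
    have "(\<Sum>c\<in>{c \<in> A. (c x, c y) = p}. H (c x) (c y)) =
        (\<Sum>c\<in>{c \<in> A. c x = fst p \<and> c y = snd p}. H (fst p) (snd p))"
      by (rule sum.cong) auto
    then show "(\<Sum>c\<in>{c \<in> A. (c x, c y) = p}. H (c x) (c y)) =
        transporter x y (fst p - snd p) * H (fst p) (snd p)"
      by (simp add: card_transporter)
  qed
  also have "\<dots> = (\<Sum>(u, v)\<in>UNIV \<times> UNIV. transporter x y (u - v) * H u v)"
    by (simp add: case_prod_unfold)
  finally show ?thesis by (simp only: sum.cartesian_product)
qed

text \<open>Grouping \<open>A\<close> by the image of the pair \<open>(x, y)\<close> turns the sum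
  into the convolution of \<open>idem a\<close>, an invariant function and \<open>idem b\<close>,
  which vanishes for different classes.\<close>

lemma schur_orthogonality:
  "(\<Sum>c\<in>A. idem a (c x - w) * idem b (c y - v)) =
    (if cls a = cls b then real (card A) / (real CARD('k ^ 'n) * idem b 0) * (idem b (x - y) * idem b (w - v)) else 0)"
proof -
  define r where "r = transporter x y"
  have r: "invariant r" unfolding r_def by (rule invariant_transporter)
  have "(\<Sum>c\<in>A. idem a (c x - w) * idem b (c y - v)) =
      (\<Sum>u\<in>UNIV. \<Sum>u'\<in>UNIV. r (u - u') * (idem a (u - w) * idem b (u' - v)))"
    unfolding r_def by (rule sum_over_group[of "\<lambda>u u'. idem a (u - w) * idem b (u' - v)"])
  also have "\<dots> = (\<Sum>u'\<in>UNIV. (\<Sum>u\<in>UNIV. idem a (w - u) * r (u - u')) * idem b (u' - v))"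
    by (subst sum.swap) (simp add: sum_distrib_left sum_distrib_right mult_ac idem_minus[of a _ w])
  also have "\<dots> = conv (conv (idem a) r) (idem b) (w - v)"
    by (simp only: conv_shift)
  also have "\<dots> = (if cls a = cls b then hat r b * idem b (w - v) else 0)"
    by (simp only: conv_idem_invariant_idem[OF r])
  finally have eq: "(\<Sum>c\<in>A. idem a (c x - w) * idem b (c y - v)) =
      (if cls a = cls b then hat r b * idem b (w - v) else 0)" .
  \<comment> \<open>The remaining scalar \<open>hat r b\<close> is found by summing the invariant
    value \<open>idem b (c x - c y)\<close> over the group in two ways.\<close>
  have "real (card A) * idem b (x - y) = (\<Sum>c\<in>A. idem b (c x - c y))"
    using invariantD[OF invariant_idem] by simp
  also have "\<dots> = (\<Sum>u\<in>UNIV. \<Sum>v\<in>UNIV. r (u - v) * idem b (u - v))"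
    unfolding r_def by (rule sum_over_group)
  also have "\<dots> = real CARD('k ^ 'n) * (hat r b * idem b 0)"
    using sum_over_differences[of "\<lambda>z. r z * idem b z"] hat_eq_sum_idem[OF r, of b] by simp
  finally have "hat r b = real (card A) / (real CARD('k ^ 'n) * idem b 0) * idem b (x - y)"
    using idem_0_pos[of b] by (simp add: field_simps)
  then show ?thesis unfolding eq by simp
qed

text \<open>The character of the irreducible constituent cut out by \<open>idem a\<close>.\<close>

definition chi :: "'k ^ 'n \<Rightarrow> ('k ^ 'n \<Rightarrow> 'k ^ 'n) \<Rightarrow> real" where
  "chi a c = (\<Sum>x\<in>UNIV. idem a (c x - x))"

text \<open>This is the trace form of the preceding orthogonality relation, taken at
  \<open>w = x\<close> and \<open>v = y\<close> and summed over both points.\<close>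

lemma chi_orthogonality:
  "(\<Sum>c\<in>A. chi a c * chi b c) = (if cls a = cls b then real (card A) else 0)"
proof -
  have "(\<Sum>c\<in>A. chi a c * chi b c) =
      (\<Sum>c\<in>A. \<Sum>x\<in>UNIV. \<Sum>y\<in>UNIV. idem a (c x - x) * idem b (c y - y))"
    by (simp add: chi_def sum_product)
  also have "\<dots> = (\<Sum>x\<in>UNIV. \<Sum>c\<in>A. \<Sum>y\<in>UNIV. idem a (c x - x) * idem b (c y - y))"
    by (rule sum.swap)
  also have "\<dots> = (\<Sum>x\<in>UNIV. \<Sum>y\<in>UNIV. \<Sum>c\<in>A. idem a (c x - x) * idem b (c y - y))"
    by (intro sum.cong refl sum.swap)
  also have "\<dots> = (if cls a = cls b then real (card A) / (real CARD('k ^ 'n) * idem b 0) *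
      (\<Sum>x\<in>UNIV. \<Sum>y\<in>UNIV. idem b (x - y) * idem b (x - y)) else 0)"
    unfolding schur_orthogonality by (simp add: sum_distrib_left)
  also have "(\<Sum>x\<in>UNIV. \<Sum>y\<in>UNIV. idem b (x - y) * idem b (x - y)) = real CARD('k ^ 'n) * idem b 0"
  proof -
    have "(\<Sum>z\<in>UNIV. idem b z * idem b z) = idem b 0"
      using hat_eq_sum_idem[OF invariant_idem, of b b] by (simp add: hat_idem)
    then show ?thesis using sum_over_differences[of "\<lambda>z. idem b z * idem b z"] by simp
  qed
  finally show ?thesis using idem_0_pos[of b] by simp
qed

lemma chi_tr: "chi a (tr b) = real CARD('k ^ 'n) * idem a b"
  by (simp add: chi_def)

lemma chi_conj:
  assumes c: "c \<in> A"
  shows "chi a (c \<circ> g \<circ> inv c) = chi a g"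
proof -
  have "chi a (c \<circ> g \<circ> inv c) = (\<Sum>x\<in>UNIV. idem a (c (g (inv c x)) - x))"
    by (simp add: chi_def)
  also have "\<dots> = (\<Sum>x\<in>UNIV. idem a (c (g (inv c (c x))) - c x))"
    by (rule sum.reindex_bij_betw[OF perm_bij[OF c], symmetric])
  also have "\<dots> = chi a g"
    using c by (simp add: chi_def invariantD[OF invariant_idem])
  finally show ?thesis .
qed

section \<open>Exceptional characters\<close>

lemma card_homothety_perms:
  "real (card (homothety_perms :: ('k ^ 'n \<Rightarrow> 'k ^ 'n) set)) \<le> real CARD('k ^ 'n) * (real CARD('k) - 1)"
proof -
  have "homothety_perms = (\<lambda>(c :: 'k, b :: 'k ^ 'n) x. c *s x + b) ` ((- {0}) \<times> UNIV)"
    by (auto simp: homothety_perms_def image_iff)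
  then have "card (homothety_perms :: ('k ^ 'n \<Rightarrow> 'k ^ 'n) set) \<le> card ((- {0 :: 'k}) \<times> (UNIV :: ('k ^ 'n) set))"
    by (metis card_image_le finite)
  also have "\<dots> = (CARD('k) - 1) * CARD('k ^ 'n)"
    by (simp add: card_cartesian_product Compl_eq_Diff_UNIV card_Diff_subset)
  finally have "real (card (homothety_perms :: ('k ^ 'n \<Rightarrow> 'k ^ 'n) set))
      \<le> real ((CARD('k) - 1) * CARD('k ^ 'n))"
    by (simp only: of_nat_le_iff)
  also have "\<dots> = real CARD('k ^ 'n) * (real CARD('k) - 1)"
    using card_field_gt_1[where 'k = 'k] by simp
  finally show ?thesis .
qed

text \<open>A class function picks up at least the contribution of the conjugates of translations, each of
  which is hit at most \<open>card K\<close> times by \<open>(c, b) \<mapsto> c \<circ> tr b \<circ> inv c\<close>.\<close>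

lemma translations_norm_le:
  fixes F :: "('k ^ 'n \<Rightarrow> 'k ^ 'n) \<Rightarrow> real"
  assumes F: "\<And>c g. c \<in> A \<Longrightarrow> F (c \<circ> g \<circ> inv c) = F g"
  shows "real (card A) * (\<Sum>b\<in>- {0}. (F (tr b))\<^sup>2)
    \<le> real CARD('k ^ 'n) * (real CARD('k) - 1) * ((\<Sum>c\<in>A. (F c)\<^sup>2) - (F id)\<^sup>2)"
proof -
  define P where "P = A \<times> (- {0 :: 'k ^ 'n})"
  define f where "f = (\<lambda>(c :: 'k ^ 'n \<Rightarrow> 'k ^ 'n, b). c \<circ> tr b \<circ> inv c :: 'k ^ 'n \<Rightarrow> 'k ^ 'n)"
  define m where "m = real CARD('k ^ 'n) * (real CARD('k) - 1)"
  have m0: "0 \<le> m" using card_field_gt_1[where 'k = 'k] by (simp add: m_def)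
  \<comment> \<open>Relative to one fixed \<open>d\<close> in the fibre, every other conjugating
    element differs by a member of \<open>homothety_perms\<close>, and \<open>c\<close> together
    with \<open>u\<close> determines \<open>b\<close>.\<close>
  have fib: "real (card {p \<in> P. f p = u}) \<le> m" for u
  proof (cases "{p \<in> P. f p = u} = {}")
    case True
    then have "card {p \<in> P. f p = u} = 0" by (simp only: card.empty)
    then show ?thesis using m0 by linarith
  next
    case False
    then obtain d b0 where d: "d \<in> A" "b0 \<noteq> 0" "d \<circ> tr b0 \<circ> inv d = u"
      by (auto simp: P_def f_def)
    have conj: "(inv d \<circ> c) \<circ> tr b \<circ> inv (inv d \<circ> c) = tr b0"
      if "c \<in> A" "c \<circ> tr b \<circ> inv c = u" for c b
    proof -
      have "inv (inv d \<circ> c) = inv c \<circ> d"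
        using that d perm_bij by (simp add: inv_comp_eq inv_in inv_inv_eq)
      then have "(inv d \<circ> c) \<circ> tr b \<circ> inv (inv d \<circ> c) = inv d \<circ> (c \<circ> tr b \<circ> inv c) \<circ> d"
        by (simp add: comp_assoc)
      also have "\<dots> = inv d \<circ> (d \<circ> tr b0 \<circ> inv d) \<circ> d"
        by (simp only: that(2) d(3))
      also have "\<dots> = tr b0" using d(1) by (auto simp: fun_eq_iff)
      finally show ?thesis .
    qed
    have "card {p \<in> P. f p = u} \<le> card (homothety_perms :: ('k ^ 'n \<Rightarrow> 'k ^ 'n) set)"
    proof (rule card_inj_on_le[where f = "\<lambda>(c, b). inv d \<circ> c"])
      show "inj_on (\<lambda>(c, b). inv d \<circ> c) {p \<in> P. f p = u}"
      proof (rule inj_onI)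
        fix p p' assume p: "p \<in> {p \<in> P. f p = u}" and p': "p' \<in> {p \<in> P. f p = u}"
          and eq: "(case p of (c, b) \<Rightarrow> inv d \<circ> c) = (case p' of (c, b) \<Rightarrow> inv d \<circ> c)"
        obtain c b where pcb: "p = (c, b)" by (cases p)
        have cb: "c \<in> A" "c \<circ> tr b \<circ> inv c = u"
          using p by (simp_all add: pcb P_def f_def)
        obtain c' b' where pcb': "p' = (c', b')" by (cases p')
        have cb': "c' \<in> A" "c' \<circ> tr b' \<circ> inv c' = u"
          using p' by (simp_all add: pcb' P_def f_def)
        have "inv d (c x) = inv d (c' x)" for x
          using fun_cong[OF eq, of x] by (simp add: pcb pcb')
        then have "c x = c' x" for x
          using apply_inv[OF d(1)] by metis
        then have cc: "c = c'" by blast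
        have "c (0 + b) = u (c 0)" "c (0 + b') = u (c 0)"
          using fun_cong[OF cb(2), of "c 0"] fun_cong[OF cb'(2), of "c 0"] cb(1) by (simp_all add: cc)
        then have "b = b'" using inv_apply[OF cb(1)] by (metis add_0)
        with cc show "p = p'" by (simp add: pcb pcb')
      qed
      show "(\<lambda>(c, b). inv d \<circ> c) ` {p \<in> P. f p = u} \<subseteq> homothety_perms"
      proof (rule image_subsetI)
        fix p assume p: "p \<in> {p \<in> P. f p = u}"
        obtain c b where pcb: "p = (c, b)" by (cases p)
        have cb: "c \<in> A" "b \<noteq> 0" "c \<circ> tr b \<circ> inv c = u"
          using p by (simp_all add: pcb P_def f_def)
        have "(inv d \<circ> c) \<circ> tr b \<circ> inv (inv d \<circ> c) \<in> range tr"
          using conj[OF cb(1,3)] by (simp only: rangeI)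
        then have "inv d \<circ> c \<in> homothety_perms"
          using cb(1,2) d(1) by (intro translation_conj_homothety comp_in inv_in)
        then show "(case p of (c, b) \<Rightarrow> inv d \<circ> c) \<in> homothety_perms"
          by (simp add: pcb)
      qed
    qed simp
    then show ?thesis using card_homothety_perms unfolding m_def by linarith
  qed
  have "real (card A) * (\<Sum>b\<in>- {0}. (F (tr b))\<^sup>2) = (\<Sum>c\<in>A. \<Sum>b\<in>- {0}. (F (c \<circ> tr b \<circ> inv c))\<^sup>2)"
    using F by simp
  also have "\<dots> = (\<Sum>p\<in>P. (F (f p))\<^sup>2)"
    by (simp add: P_def f_def sum.cartesian_product case_prod_unfold)
  also have "\<dots> = (\<Sum>u\<in>f ` P. \<Sum>p\<in>{p \<in> P. f p = u}. (F (f p))\<^sup>2)"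
    by (rule sum.image_gen) simp
  also have "\<dots> = (\<Sum>u\<in>f ` P. real (card {p \<in> P. f p = u}) * (F u)\<^sup>2)"
    by (rule sum.cong) auto
  also have "\<dots> \<le> (\<Sum>u\<in>f ` P. m * (F u)\<^sup>2)"
    by (intro sum_mono mult_right_mono fib) auto
  also have "\<dots> = m * (\<Sum>u\<in>f ` P. (F u)\<^sup>2)"
    by (simp add: sum_distrib_left)
  also have "\<dots> \<le> m * ((\<Sum>c\<in>A. (F c)\<^sup>2) - (F id)\<^sup>2)"
  proof (rule mult_left_mono)
    have "id \<notin> f ` P"
    proof
      assume "id \<in> f ` P"
      then obtain c b where cb: "c \<in> A" "b \<noteq> 0" "id = c \<circ> tr b \<circ> inv c"
        by (auto simp: P_def f_def)
      have "c 0 = c (0 + b)" using fun_cong[OF cb(3), of "c 0"] cb(1) by simp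
      then show False using cb inv_apply by (metis add_0)
    qed
    moreover have "f ` P \<subseteq> A"
      using comp_in inv_in tr_in by (auto simp: P_def f_def)
    ultimately have "f ` P \<subseteq> A - {id}" by blast
    then have "(\<Sum>u\<in>f ` P. (F u)\<^sup>2) \<le> (\<Sum>u\<in>A - {id}. (F u)\<^sup>2)"
      by (intro sum_mono2) auto
    then show "(\<Sum>u\<in>f ` P. (F u)\<^sup>2) \<le> (\<Sum>c\<in>A. (F c)\<^sup>2) - (F id)\<^sup>2"
      using id_in by (simp add: sum_diff1)
    show "0 \<le> m" by (rule m0)
  qed
  finally show ?thesis unfolding m_def .
qed

text \<open>The exceptional character argument: \<open>F\<close> and the class function induced from the difference of
  two irreducible characters of \<open>K\<close>, whose values on translations are given by \<open>\<alpha>\<close>, both have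
  norm \<open>2\<close>, and their inner product is \<open>2\<close>.\<close>

lemma invariant_xi:
  assumes a1: "a1 \<noteq> 0" and a2: "a2 \<noteq> 0" and ne: "cls a1 \<noteq> cls a2"
  shows "invariant (xi a1)"
proof -
  define q where "q = real CARD('k)"
  define n where "n = real CARD('k ^ 'n)"
  have q: "q > 1" unfolding q_def by (rule card_field_gt_1)
  have n: "n > 0" by (simp add: n_def)
  define F where "F = (\<lambda>c. chi a1 c - chi a2 c)"
  define G where "G = (\<lambda>b. n * (idem a1 b - idem a2 b))"
  \<comment> \<open>The irreducible character of \<open>homothety_perms\<close> belonging to the
    hyperplane of \<open>a\<close> has degree \<open>q - 1\<close> and value
    \<open>(q - 1) * xi a b\<close> at \<open>tr b\<close>.\<close>
  define \<alpha> where "\<alpha> = (\<lambda>b. (q - 1) * (xi a1 b - xi a2 b))"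
  have F_tr: "F (tr b) = G b" for b
    by (simp add: F_def G_def chi_tr n_def algebra_simps)
  have F_id: "F id = G 0" using F_tr[of 0] by simp
  have norm_F: "(\<Sum>c\<in>A. (F c)\<^sup>2) = 2 * real (card A)"
  proof -
    have "(F c)\<^sup>2 = chi a1 c * chi a1 c + chi a2 c * chi a2 c - 2 * (chi a1 c * chi a2 c)" for c
      by (simp add: F_def power2_eq_square algebra_simps)
    then have "(\<Sum>c\<in>A. (F c)\<^sup>2) = (\<Sum>c\<in>A. chi a1 c * chi a1 c) + (\<Sum>c\<in>A. chi a2 c * chi a2 c)
        - 2 * (\<Sum>c\<in>A. chi a1 c * chi a2 c)"
      by (simp add: sum.distrib sum_subtractf sum_distrib_left)
    then show ?thesis using ne by (simp add: chi_orthogonality)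
  qed
  have xi_ne: "xi a1 \<noteq> xi a2"
  proof
    assume "xi a1 = xi a2"
    then have "a1 \<in> cls a2" by (simp add: cls_def hat_def)
    then show False using cls_eq ne by blast
  qed
  have not: "a1 \<notin> cls a2" "a2 \<notin> cls a1" using cls_eq ne by blast+
  have hatG: "(\<Sum>x\<in>UNIV. G x * xi c x) = n * ((if c \<in> cls a1 then 1 else 0) - (if c \<in> cls a2 then 1 else 0))" for c
  proof -
    have "(\<Sum>x\<in>UNIV. G x * xi c x) = n * (hat (idem a1) c - hat (idem a2) c)"
      by (simp add: G_def hat_def sum_subtractf sum_distrib_left algebra_simps)
    then show ?thesis by (simp only: hat_idem)
  qed
  have hat\<alpha>: "(\<Sum>x\<in>UNIV. \<alpha> x * xi c x) = (q - 1) * (hat (xi a1) c - hat (xi a2) c)" for c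
    by (simp add: \<alpha>_def hat_def sum_subtractf sum.distrib sum_distrib_left algebra_simps)
  have h12: "hat (xi a1) a2 = 0" "hat (xi a2) a1 = 0"
    using xi_ne hat_xi_orthogonal by metis+
  have inner: "(\<Sum>b\<in>UNIV. H b * \<alpha> b) = (q - 1) * ((\<Sum>x\<in>UNIV. H x * xi a1 x) - (\<Sum>x\<in>UNIV. H x * xi a2 x))" for H
    by (simp add: \<alpha>_def sum_subtractf sum.distrib sum_distrib_left algebra_simps)
  have G\<alpha>: "(\<Sum>b\<in>UNIV. G b * \<alpha> b) = 2 * n * (q - 1)"
    unfolding inner hatG using not by simp
  have \<alpha>\<alpha>: "(\<Sum>b\<in>UNIV. \<alpha> b * \<alpha> b) = 2 * n * (q - 1)"
    unfolding inner hat\<alpha> using h12 hat_xi_self[OF a1] hat_xi_self[OF a2]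
    by (simp add: n_def q_def algebra_simps)
  have \<alpha>0: "\<alpha> 0 = 0" by (simp add: \<alpha>_def)
  have drop0: "(\<Sum>b\<in>UNIV. f b) = f 0 + (\<Sum>b\<in>- {0}. f b)" for f :: "'k ^ 'n \<Rightarrow> real"
    by (simp add: Compl_eq_Diff_UNIV sum.remove[of UNIV 0])
  define M where "M = real (card A)"
  have M: "M > 0" using id_in by (auto simp: M_def card_gt_0_iff)
  have "M * (\<Sum>b\<in>- {0}. (G b)\<^sup>2) \<le> n * (q - 1) * (2 * M - (G 0)\<^sup>2)"
    using translations_norm_le[of F] chi_conj unfolding F_tr norm_F F_id
    by (simp add: F_def M_def n_def q_def)
  then have G_le: "M * (\<Sum>b\<in>- {0}. (G b)\<^sup>2) \<le> M * (2 * n * (q - 1)) - n * (q - 1) * (G 0)\<^sup>2"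
    by (simp add: algebra_simps)
  \<comment> \<open>Both \<open>G\<alpha>\<close> and \<open>\<alpha>\<alpha>\<close> equal
    \<open>2 * n * (q - 1)\<close>, and \<open>\<alpha> 0 = 0\<close> lets the origin be dropped.
    The norm bound \<open>G_le\<close> then forces \<open>G = \<alpha>\<close> off the origin and
    \<open>G 0 = 0\<close>.\<close>
  have dist: "(\<Sum>b\<in>- {0}. (G b - \<alpha> b)\<^sup>2) = (\<Sum>b\<in>- {0}. (G b)\<^sup>2) - 2 * n * (q - 1)"
  proof -
    have "(G b - \<alpha> b)\<^sup>2 = (G b)\<^sup>2 - 2 * (G b * \<alpha> b) + \<alpha> b * \<alpha> b" for b
      by (simp add: power2_eq_square algebra_simps)
    then have "(\<Sum>b\<in>- {0}. (G b - \<alpha> b)\<^sup>2) =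
        (\<Sum>b\<in>- {0}. (G b)\<^sup>2) - 2 * (\<Sum>b\<in>- {0}. G b * \<alpha> b) + (\<Sum>b\<in>- {0}. \<alpha> b * \<alpha> b)"
      by (simp add: sum.distrib sum_subtractf sum_distrib_left)
    then show ?thesis
      using drop0[of "\<lambda>b. G b * \<alpha> b"] drop0[of "\<lambda>b. \<alpha> b * \<alpha> b"] G\<alpha> \<alpha>\<alpha> \<alpha>0 by simp
  qed
  have le: "M * (\<Sum>b\<in>- {0}. (G b - \<alpha> b)\<^sup>2) + n * (q - 1) * (G 0)\<^sup>2 \<le> 0"
    using G_le unfolding dist right_diff_distrib[of M] by linarith
  have nn: "(\<Sum>b\<in>- {0}. (G b - \<alpha> b)\<^sup>2) \<ge> 0" by (simp add: sum_nonneg)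
  have "M * (\<Sum>b\<in>- {0}. (G b - \<alpha> b)\<^sup>2) \<ge> 0" "n * (q - 1) * (G 0)\<^sup>2 \<ge> 0"
    using nn M n q by simp_all
  with le have "M * (\<Sum>b\<in>- {0}. (G b - \<alpha> b)\<^sup>2) = 0" "n * (q - 1) * (G 0)\<^sup>2 = 0"
    by linarith+
  then have sum0: "(\<Sum>b\<in>- {0}. (G b - \<alpha> b)\<^sup>2) = 0" and G0: "G 0 = 0"
    using M n q by simp_all
  have "G b = \<alpha> b" for b
  proof (cases "b = 0")
    case False
    then show ?thesis using sum0 by (simp add: sum_nonneg_eq_0_iff)
  qed (simp add: G0 \<alpha>0)
  then have key: "n * ((if c \<in> cls a1 then 1 else 0) - (if c \<in> cls a2 then 1 else 0))
      = (q - 1) * (hat (xi a1) c - hat (xi a2) c)" for c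
    using hatG[of c] hat\<alpha>[of c] by simp
  \<comment> \<open>For a \<open>c\<close> in \<open>cls a1\<close> with another hyperplane, the
    left side of \<open>key\<close> is \<open>n > 0\<close>, while the right side is at most
    zero.\<close>
  have xi_cls: "xi c = xi a1" if c: "c \<in> cls a1" for c
  proof (rule ccontr)
    assume "xi c \<noteq> xi a1"
    then have "hat (xi a1) c = 0" using hat_xi_orthogonal by metis
    moreover have "c \<notin> cls a2" using c cls_eq ne by metis
    ultimately have "n = - ((q - 1) * hat (xi a2) c)" using key[of c] c by simp
    moreover have "(q - 1) * hat (xi a2) c \<ge> 0" using q hat_xi_nonneg[of a2 c] by simp
    ultimately show False using n by simp
  qed
  have "(\<Sum>b\<in>cls a1. xi b x) = (\<Sum>b\<in>cls a1. xi a1 x)" for x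
    by (rule sum.cong[OF refl]) (erule xi_cls[THEN fun_cong])
  then have eq: "idem a1 x = idem a1 0 * xi a1 x" for x
    by (simp add: idem_def)
  have "xi a1 x = 1 / idem a1 0 * idem a1 x + 0 * idem a1 x" for x
    using eq[of x] idem_0_pos[of a1] by simp
  then have "xi a1 = (\<lambda>x. 1 / idem a1 0 * idem a1 x + 0 * idem a1 x)"
    by blast
  moreover have "invariant (\<lambda>x. 1 / idem a1 0 * idem a1 x + 0 * idem a1 x)"
    by (rule invariant_linear[OF invariant_idem invariant_idem])
  ultimately show ?thesis by (simp only:)
qed

section \<open>The two extreme partitions\<close>

text \<open>The transform of \<open>f\<close> is constant off zero, so by inversion \<open>f\<close>
  is a combination of the delta function and a constant.\<close>

lemma invariant_const_if_cls_trivial: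
  assumes cls: "\<And>a b. a \<noteq> 0 \<Longrightarrow> b \<noteq> 0 \<Longrightarrow> cls a = cls b"
    and f: "invariant f" and x: "x \<noteq> 0" and y: "y \<noteq> 0"
  shows "f x = f y"
proof -
  have hat: "hat f a = hat f x" if "a \<noteq> 0" for a
    using cls[OF that x] cls_self[of a] f by (auto simp: cls_def)
  have expand: "real CARD('k ^ 'n) * f z = hat f 0 - hat f x" if "z \<noteq> 0" for z
  proof -
    have "real CARD('k ^ 'n) * f z = (\<Sum>a\<in>UNIV. hat f a * xi a z)"
      using f by (intro fourier_inversion invariant_homogeneous)
    also have "\<dots> = (\<Sum>a\<in>UNIV. (if a = 0 then hat f 0 - hat f x else 0) + hat f x * xi a z)"
      using hat by (intro sum.cong) (auto simp: algebra_simps)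
    also have "\<dots> = hat f 0 - hat f x + hat f x * (\<Sum>a\<in>UNIV. xi a z)"
      by (simp add: sum.distrib sum_distrib_left)
    finally show ?thesis using that by (simp add: sum_xi_left)
  qed
  have "real CARD('k ^ 'n) * f x = real CARD('k ^ 'n) * f y"
    using expand[OF x] expand[OF y] by (simp only:)
  then show ?thesis by simp
qed


text \<open>Invariance of every \<open>xi a\<close> says that \<open>c u - c v\<close> and
  \<open>u - v\<close> are orthogonal to the same vectors, hence parallel. So each element of
  \<open>A\<close> is a dilatation.\<close>

lemma xi_invariant_imp_homothety:
  assumes dim: "2 \<le> CARD('n)" and inv: "\<And>a. a \<noteq> 0 \<Longrightarrow> invariant (xi a)"
  shows "A = homothety_perms"
proof -
  have "c \<in> homothety_perms" if c: "c \<in> A" for c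
  proof -
    have xi1: "xi a x = 1 \<longleftrightarrow> dotp a x = 0" for a x :: "'k ^ 'n"
    proof -
      have "- 1 / (real CARD('k) - 1) < 1"
        using card_field_gt_1[where 'k = 'k] by (simp add: field_simps)
      then show ?thesis unfolding xi_def by (metis order_less_irrefl)
    qed
    have dot: "dotp a (c u - c v) = 0 \<longleftrightarrow> dotp a (u - v) = 0" for a u v
      using invariantD[OF inv c, of a u v] by (cases "a = 0") (simp_all add: xi1[symmetric])
    have par: "\<exists>k. (c u - c 0) - (c v - c 0) = k *s (u - v)" for u v
    proof (cases "u = v")
      case False
      then obtain k where "c u - c v = k *s (u - v)"
        using dotp_orthogonal_imp_multiple[of "u - v" "c u - c v"] dot by auto
      then show ?thesis by auto
    qed (auto intro: exI[of _ 0])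
    obtain k where k: "(\<lambda>x. c x - c 0) = (*s) k"
      using central_dilatation_is_scaling[OF dim, of "\<lambda>x. c x - c 0"] par by auto
    have ck: "c x = k *s x + c 0" for x using fun_cong[OF k, of x] by (simp add: algebra_simps)
    have "k \<noteq> 0"
    proof
      assume "k = 0"
      then have "c x = c 0" for x using ck[of x] by simp
      then have "x = 0" for x :: "'k ^ 'n" using inv_apply[OF c] by metis
      then show False by (metis exists_not_multiple[OF dim])
    qed
    moreover have "c = (\<lambda>x. k *s x + c 0)" using ck by blast
    ultimately show ?thesis unfolding homothety_perms_def by blast
  qed
  then show ?thesis using homothety_subset by blast
qed

end

section \<open>Automorphism groups of graphs and the final dichotomy\<close>

lemma perm_group_graph_aut: "perm_group (graph_aut E)"
proof
  fix c assume c: "c \<in> graph_aut E"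
  then show b: "bij c" by (simp add: graph_aut_def)
  show "c \<circ> d \<in> graph_aut E" if "d \<in> graph_aut E" for d
    using c that by (auto simp: graph_aut_def intro: bij_comp)
  have "E (inv c u) (inv c v) \<longleftrightarrow> E u v" for u v
  proof -
    have "E (c (inv c u)) (c (inv c v)) \<longleftrightarrow> E (inv c u) (inv c v)"
      using c unfolding graph_aut_def by blast
    then show ?thesis using b by (simp add: bij_is_surj surj_f_inv_f)
  qed
  then show "inv c \<in> graph_aut E" using b by (simp add: graph_aut_def bij_imp_bij_inv)
qed (auto simp: graph_aut_def)

text \<open>Every additive bijection preserves such a set \<open>S\<close>, and conjugates
  translations to translations. The transvection sending \<open>axis i 1\<close> to
  \<open>axis i 1 + axis j 1\<close> is one that is not a homothety.\<close>

lemma transvection_normalizes: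
  fixes S :: "('k::{field,finite} ^ 'n::finite) set"
  assumes dim: "2 \<le> CARD('n)" and S: "\<And>x y. x \<noteq> 0 \<Longrightarrow> y \<noteq> 0 \<Longrightarrow> x \<in> S \<longleftrightarrow> y \<in> S"
  shows "\<exists>\<phi> \<in> graph_aut (cayley_graph S) - homothety_perms.
    normalizes_perms \<phi> (translation_perms :: ('k ^ 'n \<Rightarrow> 'k ^ 'n) set)"
proof -
  obtain i j :: 'n where ij: "i \<noteq> j"
    using dim card_le_Suc0_iff_eq[of "UNIV :: 'n set"] by auto
  define f where "f = (\<lambda>x :: 'k ^ 'n. x + x $ i *s axis j 1)"
  define g where "g = (\<lambda>x :: 'k ^ 'n. x - x $ i *s axis j 1)"
  have aj: "axis j (1 :: 'k) $ i = 0" using ij by (simp add: axis_def)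
  have fg: "f (g x) = x" "g (f x) = x" for x
    using aj by (simp_all add: f_def g_def)
  have f_add: "f (x + y) = f x + f y" for x y
    by (simp add: f_def vector_sadd_rdistrib)
  have f_diff: "f x - f y = f (x - y)" for x y
    by (simp add: f_def vector_sub_rdistrib)
  have f0: "f 0 = 0" by (simp add: f_def)
  have fx0: "f x = 0 \<longleftrightarrow> x = 0" for x using fg(2)[of x] fg(2)[of 0] f0 by metis
  have bij: "bij f" by (rule o_bij[of g]) (auto simp: fg)
  have inv_f: "inv f = g" by (rule inv_equality) (simp_all add: fg)
  have "f x \<in> S \<longleftrightarrow> x \<in> S" for x
    using S[of "f x" x] fx0[of x] f0 by (cases "x = 0") auto
  then have "f \<in> graph_aut (cayley_graph S)"
    using bij by (simp add: graph_aut_def cayley_graph_def f_diff)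
  moreover have "f \<notin> homothety_perms"
  proof
    assume "f \<in> homothety_perms"
    then obtain c b where cb: "f = (\<lambda>x. c *s x + b)" by (auto simp: homothety_perms_def)
    have b: "b = 0" using fun_cong[OF cb, of 0] f0 by simp
    have "f (axis i 1) $ j = 0" using ij by (simp add: cb b axis_def)
    moreover have "f (axis i 1) $ j = 1" using ij by (simp add: f_def axis_def)
    ultimately show False by simp
  qed
  moreover have "normalizes_perms f translation_perms"
  proof -
    have "f \<circ> tr b \<circ> g = tr (f b)" for b by (auto simp: f_add fg)
    then have "(\<lambda>h. f \<circ> h \<circ> inv f) ` range tr = tr ` range f"
      unfolding inv_f by (simp add: image_image)
    then show ?thesis
      using bij by (simp add: normalizes_perms_def translation_perms_eq bij_is_surj)
  qed
  ultimately show ?thesis by blast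
qed

theorem theorem1p2:
  fixes S :: "('k::{field,finite} ^ 'n::finite) set"
  assumes n_ge_2: "CARD('n) \<ge> 2"
    and S_inverse_closed: "S = uminus ` S"
    and K_le_Aut: "(homothety_perms :: ('k ^ 'n \<Rightarrow> 'k ^ 'n) set) \<subseteq> graph_aut (cayley_graph S)"
  shows "graph_aut (cayley_graph S) = homothety_perms \<or>
    (\<exists>\<phi> \<in> graph_aut (cayley_graph S) - homothety_perms.
      normalizes_perms \<phi> (translation_perms :: ('k ^ 'n \<Rightarrow> 'k ^ 'n) set))"
proof (rule disjCI)
  assume no_phi: "\<not> (\<exists>\<phi> \<in> graph_aut (cayley_graph S) - homothety_perms.
      normalizes_perms \<phi> (translation_perms :: ('k ^ 'n \<Rightarrow> 'k ^ 'n) set))"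
  interpret perm_group "graph_aut (cayley_graph S)" by (rule perm_group_graph_aut)
  interpret homothety_overgroup "graph_aut (cayley_graph S)"
    by standard (use K_le_Aut no_phi in auto)
  show "graph_aut (cayley_graph S) = homothety_perms"
  proof (cases "\<exists>a b. a \<noteq> 0 \<and> b \<noteq> 0 \<and> cls a \<noteq> cls b")
    case True
    then obtain a1 a2 where a: "a1 \<noteq> 0" "a2 \<noteq> 0" "cls a1 \<noteq> cls a2" by blast
    \<comment> \<open>The class of \<open>a\<close> differs from at least one of the two distinct
      classes, which supplies the partner needed for \<open>invariant_xi\<close>.\<close>
    have "invariant (xi a)" if "a \<noteq> 0" for a
    proof (cases "cls a = cls a1")
      case True
      then show ?thesis using invariant_xi[OF that a(2)] a(3) by simp
    next
      case False
      then show ?thesis by (rule invariant_xi[OF that a(1)])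
    qed
    then show ?thesis by (rule xi_invariant_imp_homothety[OF n_ge_2])
  next
    case False
    \<comment> \<open>With a single class, this indicator is constant off zero, so a transvection
      would contradict \<open>no_phi\<close>.\<close>
    have "invariant (\<lambda>x. if x \<in> S then 1 else 0)"
      unfolding invariant_def by (auto simp: graph_aut_def cayley_graph_def)
    from invariant_const_if_cls_trivial[OF _ this] False
    have "x \<in> S \<longleftrightarrow> y \<in> S" if "x \<noteq> 0" "y \<noteq> 0" for x y
      using that by (metis zero_neq_one)
    from transvection_normalizes[OF n_ge_2 this] no_phi show ?thesis by blast
  qed
qed

end
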